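(* Let $\mathbb{F}$ be a subfield of $\mathbb{C}$ and let $1\le r\le s$ be integers. Let $(P,\widetilde P)$ be a pair of $r\times s$ matrices of Laurent polynomials with coefficients in $\mathbb{F}$ such that the symmetry of each of $P,\widetilde P$ is compatible, with $$\mathcal{S}P=\mathcal{S}\widetilde P=(\mathcal{S}\theta_1)^*\,\mathcal{S}\theta_2$$ for some $1\times r$ and $1\times s$ row vectors $\theta_1,\theta_2$ of Laurent polynomials with symmetry. Moreover, suppose that $P(z)\widetilde P^*(z)=I_r$ for all $z\in\mathbb{C}\setminus\{0\}$. Then there exists a pair of $s\times s$ square matrices $(P_e,\widetilde P_e)$ of Laurent polynomials with coefficients in $\mathbb{F}$ such that: (i) $[I_r,\mathbf{0}]P_e=P$ and $[I_r,\mathbf{0}]\widetilde P_e=\widetilde P$; that is, the submatrices of the first $r$ rows of $P_e,\widetilde P_e$ are $P,\widetilde P$, respectively; (ii) $P_e$ and $\widetilde P_e$ are biorthogonal: $P_e(z)\widetilde P_e^*(z)=I_s$ for all $z\in\mathbb{C}\setminus\{0\}$; (iii) the symmetry of each of $P_e,\widetilde P_e$ is compatible: $\mathcal{S}P_e=\mathcal{S}\widetilde P_e=(\mathcal{S}\theta)^*\,\mathcal{S}\theta_2$ for some $1\times s$ row vector $\theta$ of Laurent polynomials with symmetry; (iv) $P_e,\widetilde P_e$ can be represented as $$P_e(z)=P_J(z)\cdots P_1(z),\qquad \widetilde P_e(z)=\widetilde P_J(z)\cdots\widetilde P_1(z),$$ where $P_j,\widetilde P_j$, $1\le j\le J$,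 are $s\times s$ matrices of Laurent polynomials with symmetry that satisfy $P_j(z)\widetilde P_j^*(z)=I_s$. Moreover, each pair $(P_{j+1},P_j)$ and $(\widetilde P_{j+1},\widetilde P_j)$ has mutually compatible symmetry for all $j=1,\ldots,J-1$; (v) if $r=1$, then the coefficient supports of $P_e,\widetilde P_e$ are controlled by those of $P,\widetilde P$ in the following sense: $$\max_{1\le j,k\le s}\bigl\{|\mathrm{csupp}([P_e]_{j,k})|,\ |\mathrm{csupp}([\widetilde P_e]_{j,k})|\bigr\}\le \max_{1\le\ell\le s}|\mathrm{csupp}([P]_\ell)|+\max_{1\le\ell\le s}|\mathrm{csupp}([\widetilde P]_\ell)|.$$
   Context: Throughout, Laurent polynomials have coefficients in the subfield $\mathbb{F}\subseteq\mathbb{C}$. A Laurent polynomial $p(z)=\sum_{k\in\mathbb{Z}}p_kz^k$ has symmetry if there exist $\varepsilon\in\{-1,1\}$ and $c\in\mathbb{Z}$ with $p_{c-k}=\varepsilon p_k$ for all $k\in\mathbb{Z}$. The symmetry operator is $\mathcal{S}p(z):=p(z)/p(1/z)$; for $p\ne 0$ the condition that $p_{c-k}=\varepsilon p_k$ for all $k\in\mathbb{Z}$ is equivalent to $\mathcal{S}p(z)=\varepsilon z^c$. Convention for the zero polynomial: $\mathcal{S}0$ may be assigned any pattern, i.e. in every identity in which $\mathcal{S}0$ occurs it is understood to be an appropriate choice of $\varepsilon z^c$ ($\varepsilon\in\{-1,1\}$, $c\in\mathbb{Z}$) so that the identity holds. A matrix (or vector) of Laurent polynomials has symmetry if every entry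 does, and then $\mathcal{S}$ is applied entrywise: $[\mathcal{S}P]_{j,k}:=\mathcal{S}([P]_{j,k})$, where $[P]_{j,k}$ is the $(j,k)$-entry. For a row vector $P$ (the case $r=1$), $[P]_\ell$ denotes its $\ell$-th entry. For a matrix $P(z)=\sum_kP_kz^k$, $P^*(z):=\sum_k\overline{P_k}^{\,T}z^{-k}$. An $r\times s$ matrix $P$ of Laurent polynomials with symmetry has compatible symmetry if $\mathcal{S}P(z)=(\mathcal{S}\theta_1)^*(z)\,\mathcal{S}\theta_2(z)$ for some $1\times r$ and $1\times s$ row vectors $\theta_1,\theta_2$ of Laurent polynomials with symmetry. For an $r\times s$ matrix $P$ and an $s\times t$ matrix $Q$, the pair $(P,Q)$ has mutually compatible symmetry if $\mathcal{S}P=(\mathcal{S}\theta_1)^*\mathcal{S}\theta$ and $\mathcal{S}Q=(\mathcal{S}\theta)^*\mathcal{S}\theta_2$ for some $1\times r$, $1\times s$, $1\times t$ row vectors $\theta_1,\theta,\theta_2$ of Laurent polynomials with symmetry. Coefficient support: if $P=\sum_kP_kz^k$ with $P_k=\mathbf{0}$ for $k\notin[m,n]$, $P_m\neq\mathbf{0}$ and $P_n\ne\mathbf{0}$, then $\mathrm{csupp}(P):=[m,n]$ and $|\mathrm{csupp}(P)|:=n-m$; also $\mathrm{csupp}(\mathbf{0}):=\emptyset$ and $|\mathrm{csupp}(\mathbf{0})|:=-\infty$. $\mathbf{0}$ denotes a zero matrix of the appropriate size.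
   Formalization: The formal version also assumes that P^* and P̃^* have coefficients in F (automatic if F is closed under conjugation); without this the claim fails, e.g. F=Q(d), d a non-real cube root of 2, P=[1,0], P̃=[1,d]. *)

theory Defs
  imports
    Complex_Main
    "HOL-Library.Poly_Mapping"
    "HOL-Library.Extended_Real"
    "Jordan_Normal_Form.Matrix"
begin

text \<open>Finitely supported maps from \<open>int\<close> to \<open>complex\<close> with the convolution product of
  \<open>Poly_Mapping\<close> are the ring of Laurent polynomials.\<close>

type_synonym laurent = "int \<Rightarrow>\<^sub>0 complex"

abbreviation lcoeff :: "laurent \<Rightarrow> int \<Rightarrow> complex" where
  "lcoeff \<equiv> Poly_Mapping.lookup"

abbreviation lsupp :: "laurent \<Rightarrow> int set" where
  "lsupp \<equiv> Poly_Mapping.keys"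

abbreviation lmonom :: "int \<Rightarrow> complex \<Rightarrow> laurent" where
  "lmonom \<equiv> Poly_Mapping.single"

definition complex_subfield :: "complex set \<Rightarrow> bool" where
  "complex_subfield F \<longleftrightarrow> 0 \<in> F \<and> 1 \<in> F \<and>
     (\<forall>x\<in>F. \<forall>y\<in>F. x + y \<in> F \<and> x * y \<in> F) \<and> (\<forall>x\<in>F. - x \<in> F \<and> inverse x \<in> F)"

definition lp_eval :: "complex \<Rightarrow> laurent \<Rightarrow> complex" where
  "lp_eval z p = (\<Sum>k\<in>lsupp p. lcoeff p k * z powi k)"

text \<open>\<open>p(1/z)\<close> and \<open>p\<^sup>*(z)\<close> as Laurent polynomials.\<close>

definition lp_reflect :: "laurent \<Rightarrow> laurent" where
  "lp_reflect p = (\<Sum>k\<in>lsupp p. lmonom (- k) (lcoeff p k))"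

definition lp_star :: "laurent \<Rightarrow> laurent" where
  "lp_star p = (\<Sum>k\<in>lsupp p. lmonom (- k) (cnj (lcoeff p k)))"

definition has_symmetry :: "laurent \<Rightarrow> bool" where
  "has_symmetry p \<longleftrightarrow> (\<exists>\<epsilon>\<in>{-1, 1}. \<exists>c. \<forall>k. lcoeff p (c - k) = \<epsilon> * lcoeff p k)"

text \<open>\<open>Sop p\<close> is the set of admissible values \<open>\<epsilon> z^c\<close> of \<open>S p = p(z) / p(1/z)\<close>. It has exactly one
  element if \<open>p \<noteq> 0\<close> has symmetry, is empty if \<open>p\<close> has no symmetry, and consists of all
  \<open>\<epsilon> z^c\<close> if \<open>p = 0\<close>, which is the convention for \<open>S 0\<close>.\<close>

definition Sop :: "laurent \<Rightarrow> laurent set" where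
  "Sop p = {m. (\<exists>\<epsilon>\<in>{-1, 1}. \<exists>c. m = lmonom c \<epsilon>) \<and> p = m * lp_reflect p}"

type_synonym lmat = "laurent mat"

definition lmat_eval :: "complex \<Rightarrow> lmat \<Rightarrow> complex mat" where
  "lmat_eval z P = map_mat (lp_eval z) P"

definition lmat_star :: "lmat \<Rightarrow> lmat" where
  "lmat_star P = map_mat lp_star (transpose_mat P)"

definition lmat_over :: "complex set \<Rightarrow> lmat \<Rightarrow> bool" where
  "lmat_over F P \<longleftrightarrow> (\<forall>i<dim_row P. \<forall>j<dim_col P. \<forall>k. lcoeff (P $$ (i, j)) k \<in> F)"

text \<open>The \<open>r \<times> s\<close> matrices of Laurent polynomials with coefficients in \<open>F\<close>; row vectors
  are the case \<open>r = 1\<close>. Since \<open>F\<close> need not be closed under conjugation, \<open>P \<in> lmats F r s\<close>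
  does not imply \<open>lmat_over F (lmat_star P)\<close>; matrix extension over \<open>F\<close> needs both: for
  \<open>F = \<rat>(d)\<close> with a non-real cube root \<open>d\<close> of 2, \<open>P = [1, 0]\<close> and \<open>Q = [1, d]\<close> satisfy
  \<open>P Q\<^sup>* = 1\<close>, but a further row \<open>[e, f] \<noteq> 0\<close> with \<open>e + f cnj d = 0\<close> is not over \<open>F\<close>.\<close>

definition lmats :: "complex set \<Rightarrow> nat \<Rightarrow> nat \<Rightarrow> lmat set" where
  "lmats F r s = {P \<in> carrier_mat r s. lmat_over F P}"

definition mat_has_symmetry :: "lmat \<Rightarrow> bool" where
  "mat_has_symmetry P \<longleftrightarrow> (\<forall>i<dim_row P. \<forall>j<dim_col P. has_symmetry (P $$ (i, j)))"

definition Sop_mat :: "lmat \<Rightarrow> lmat set" where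
  "Sop_mat P = {M \<in> carrier_mat (dim_row P) (dim_col P).
     \<forall>i<dim_row P. \<forall>j<dim_col P. M $$ (i, j) \<in> Sop (P $$ (i, j))}"

text \<open>An identity \<open>S P = (S \<theta>\<^sub>1)\<^sup>* S \<theta>\<^sub>2\<close> reads \<open>lmat_star T\<^sub>1 * T\<^sub>2 \<in> Sop_mat P\<close> with
  \<open>T\<^sub>1 \<in> Sop_mat \<theta>\<^sub>1\<close> and \<open>T\<^sub>2 \<in> Sop_mat \<theta>\<^sub>2\<close>. The value \<open>T\<close> chosen for the vector \<open>\<theta>\<close> shared by
  the two identities below is the same in both: otherwise a zero \<open>\<theta>\<close> would make the
  condition on the pair split into two unrelated ones.\<close>

definition mutually_compatible :: "complex set \<Rightarrow> lmat \<Rightarrow> lmat \<Rightarrow> bool" where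
  "mutually_compatible F P Q \<longleftrightarrow> dim_col P = dim_row Q \<and>
     (\<exists>\<theta>\<^sub>1 \<in> lmats F 1 (dim_row P). \<exists>\<theta> \<in> lmats F 1 (dim_col P). \<exists>\<theta>\<^sub>2 \<in> lmats F 1 (dim_col Q).
        mat_has_symmetry \<theta>\<^sub>1 \<and> mat_has_symmetry \<theta> \<and> mat_has_symmetry \<theta>\<^sub>2 \<and>
        (\<exists>T\<^sub>1 \<in> Sop_mat \<theta>\<^sub>1. \<exists>T \<in> Sop_mat \<theta>. \<exists>T\<^sub>2 \<in> Sop_mat \<theta>\<^sub>2.
           lmat_star T\<^sub>1 * T \<in> Sop_mat P \<and> lmat_star T * T\<^sub>2 \<in> Sop_mat Q))"

definition biorthogonal :: "lmat \<Rightarrow> lmat \<Rightarrow> bool" where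
  "biorthogonal P Q \<longleftrightarrow>
     (\<forall>z. z \<noteq> 0 \<longrightarrow> lmat_eval z P * lmat_eval z (lmat_star Q) = 1\<^sub>m (dim_row P))"

text \<open>\<open>A J * \<dots> * A 1\<close>, with the highest index on the left.\<close>

primrec desc_prod :: "nat \<Rightarrow> (nat \<Rightarrow> lmat) \<Rightarrow> nat \<Rightarrow> lmat" where
  "desc_prod s A 0 = 1\<^sub>m s"
| "desc_prod s A (Suc j) = A (Suc j) * desc_prod s A j"

definition csupp_len :: "laurent \<Rightarrow> ereal" where
  "csupp_len p = (if p = 0 then - \<infinity> else ereal (of_int (Max (lsupp p) - Min (lsupp p))))"

definition max_csupp_len :: "lmat \<Rightarrow> ereal" where
  "max_csupp_len P = Max {csupp_len (P $$ (i, j)) | i j. i < dim_row P \<and> j < dim_col P}"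

lemma lcoeff_sum_monom:
  fixes h :: "int \<Rightarrow> int"
  assumes "finite A" and "inj h"
  shows "lcoeff (\<Sum>j\<in>A. lmonom (h j) (f j)) (h i) = (if i \<in> A then f i else 0)"
  using assms by (simp add: Poly_Mapping.lookup_sum Poly_Mapping.lookup_single when_def inj_eq)

lemma lcoeff_lp_reflect: "lcoeff (lp_reflect p) k = lcoeff p (- k)"
  using lcoeff_sum_monom[of "lsupp p" uminus "lcoeff p" "- k"]
  by (simp add: lp_reflect_def in_keys_iff)

lemma lcoeff_lp_star: "lcoeff (lp_star p) k = cnj (lcoeff p (- k))"
  using lcoeff_sum_monom[of "lsupp p" uminus "\<lambda>j. cnj (lcoeff p j)" "- k"]
  by (simp add: lp_star_def in_keys_iff)

lemma lcoeff_monom_mult: "lcoeff (lmonom c a * p) k = a * lcoeff p (k - c)"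
proof -
  have "(\<Sum>j\<in>lsupp p. lmonom j (lcoeff p j)) = p"
    by (intro poly_mapping_eqI)
      (simp add: Poly_Mapping.lookup_sum Poly_Mapping.lookup_single when_def in_keys_iff)
  hence "lmonom c a * p = lmonom c a * (\<Sum>j\<in>lsupp p. lmonom j (lcoeff p j))"
    by (rule arg_cong[where f = "\<lambda>q. lmonom c a * q", OF sym])
  also have "\<dots> = (\<Sum>j\<in>lsupp p. lmonom (c + j) (a * lcoeff p j))"
    by (simp add: sum_distrib_left Poly_Mapping.mult_single)
  finally show ?thesis
    using lcoeff_sum_monom[of "lsupp p" "\<lambda>j. c + j" "\<lambda>j. a * lcoeff p j" "k - c"]
    by (simp add: in_keys_iff)
qed

lemma lmonom_in_Sop_iff:
  assumes "\<epsilon> \<in> {-1, 1}"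
  shows "lmonom c \<epsilon> \<in> Sop p \<longleftrightarrow> (\<forall>k. lcoeff p (c - k) = \<epsilon> * lcoeff p k)"
proof -
  have "\<epsilon> * \<epsilon> = 1"
    using assms by auto
  hence flip: "x = \<epsilon> * y \<longleftrightarrow> y = \<epsilon> * x" for x y
    by (metis mult.assoc mult_1)
  have "p = lmonom c \<epsilon> * lp_reflect p \<longleftrightarrow> (\<forall>k. lcoeff p k = \<epsilon> * lcoeff p (c - k))"
    unfolding poly_mapping_eq_iff fun_eq_iff lcoeff_monom_mult lcoeff_lp_reflect by simp
  also have "\<dots> \<longleftrightarrow> (\<forall>k. lcoeff p (c - k) = \<epsilon> * lcoeff p k)"
    using flip by blast
  finally show ?thesis
    unfolding Sop_def using assms by blast
qed

lemma has_symmetry_iff_Sop: "has_symmetry p \<longleftrightarrow> Sop p \<noteq> {}"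
proof
  assume "has_symmetry p"
  then obtain \<epsilon> c where "\<epsilon> \<in> {-1, 1}" "\<forall>k. lcoeff p (c - k) = \<epsilon> * lcoeff p k"
    unfolding has_symmetry_def by blast
  thus "Sop p \<noteq> {}"
    using lmonom_in_Sop_iff by blast
next
  assume "Sop p \<noteq> {}"
  then obtain \<epsilon> c where e: "\<epsilon> \<in> {-1, 1}" and m: "lmonom c \<epsilon> \<in> Sop p"
    unfolding Sop_def by blast
  show "has_symmetry p"
    unfolding has_symmetry_def using e m lmonom_in_Sop_iff[OF e] by blast
qed

end

(* Put Q = Pt^*, so that P Q = I_r; a pair (U, V) of inverse s x s matrices extending P by rows and
   Q by columns gives Pe = U and Pte = V^*. Rows are added one at a time: if (U, V) extends the first
   r - 1 rows, the row p = P_r V and the column q = U Q_r vanish in the first r - 1 places, and p q = 1.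

   For a single row p the columns completing q are a basis of the kernel of p. It is computed as an
   order basis, here with symmetry: starting from the unit vectors with weights w_l in {0, 1}, keep a
   unimodular matrix G of symmetric columns with weights b_i such that p G_i has length at most
   D + b_i, and such that any x of weighted length at most delta, for which p x has length at most
   D + delta, has coordinates of length at most delta - b_i. Lowering D by 2 raises the sum of the
   weights by at most 2; hence for very small D only one entry of p G is nonzero. Applied to the
   columns of I - q p, which lie in the kernel of p, the property of coordinates bounds the rows of U
   by |csupp p| + |csupp q| - b_i, hence also b_i and the columns of V by |csupp p| + |csupp q|. The
   factorization (iv) may consist of the single factor Pe. *)
theory Submission
  imports Defs
begin

section \<open>Evaluation of Laurent polynomials\<close>

text \<open>Symmetry restricts the elementary operations. Column \<open>i\<close> may reduce column
  \<open>k\<close> only through a multiplier of sign \<open>f i * f k\<close>, centre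
  \<open>d k - d i\<close> and length at most \<open>b k - b i\<close>. If
  \<open>b i \<le> b k\<close>, one with leading coefficient 1 exists, except when the weights are
  equal and the signs opposite. So elimination with a pivot of least weight can leave offending
  columns of the pivot's weight and the opposite sign. Then a unimodular 2x2 mix raises two weights
  by 1 each, where otherwise one weight rises by 2; either way the sum grows by 2. A symmetric
  polynomial attains a length bound only if the bound has the parity of its centre. This is why
  \<open>D\<close> moves in steps of 2 and why the weights carry a parity. A vector in the kernel of
  \<open>p\<close> meets the condition on its product with \<open>p\<close> for every
  \<open>D\<close>, however negative. Hence lowering \<open>D\<close> until a single entry survives
  costs nothing in the length bounds for the completed matrix.\<close>

lemma lcoeff_mult: "lcoeff (f * g) n = (\<Sum>k\<in>lsupp f. lcoeff f k * lcoeff g (n - k))"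
proof -
  have "f * g = (\<Sum>k\<in>lsupp f. lmonom k (lcoeff f k)) * g"
    by (rule arg_cong[where f = "\<lambda>h. h * g"], rule poly_mapping_eqI)
      (simp add: Poly_Mapping.lookup_sum Poly_Mapping.lookup_single when_def in_keys_iff)
  thus ?thesis
    by (simp add: sum_distrib_right Poly_Mapping.lookup_sum lcoeff_monom_mult)
qed

lemma lp_eval_superset:
  assumes "finite A" "lsupp p \<subseteq> A"
  shows "lp_eval z p = (\<Sum>k\<in>A. lcoeff p k * z powi k)"
  unfolding lp_eval_def using assms by (intro sum.mono_neutral_left) (auto simp: in_keys_iff)

lemma lp_eval_add: "lp_eval z (p + q) = lp_eval z p + lp_eval z q"
proof -
  let ?A = "lsupp p \<union> lsupp q"
  have "lsupp (p + q) \<subseteq> ?A" by (rule keys_add)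
  thus ?thesis
    using lp_eval_superset[of ?A "p + q" z] lp_eval_superset[of ?A p z] lp_eval_superset[of ?A q z]
    by (simp add: lookup_add distrib_right sum.distrib)
qed

lemma lp_eval_0 [simp]: "lp_eval z 0 = 0"
  by (simp add: lp_eval_def)

lemma lp_eval_sum: "lp_eval z (sum f A) = (\<Sum>i\<in>A. lp_eval z (f i))"
  by (induction A rule: infinite_finite_induct) (auto simp: lp_eval_add)

lemma lp_eval_monom: "lp_eval z (lmonom k a) = a * z powi k"
  by (simp add: lp_eval_def)

lemma lp_eval_1 [simp]: "lp_eval z 1 = 1"
  using lp_eval_monom[of z 0 1] by simp

lemma lp_eval_mult:
  assumes "z \<noteq> 0"
  shows "lp_eval z (p * q) = lp_eval z p * lp_eval z q"
proof -
  have expand: "(\<Sum>k\<in>lsupp f. lmonom k (lcoeff f k)) = f" for f :: laurent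
    by (rule poly_mapping_eqI)
      (simp add: Poly_Mapping.lookup_sum Poly_Mapping.lookup_single when_def in_keys_iff)
  have "p * q = (\<Sum>j\<in>lsupp p. \<Sum>k\<in>lsupp q. lmonom (j + k) (lcoeff p j * lcoeff q k))"
    by (subst (1) expand[of p, symmetric], subst (1) expand[of q, symmetric])
      (simp add: sum_product mult_single)
  hence "lp_eval z (p * q) =
      (\<Sum>j\<in>lsupp p. \<Sum>k\<in>lsupp q. lcoeff p j * lcoeff q k * z powi (j + k))"
    by (simp only: lp_eval_sum lp_eval_monom)
  also have "\<dots> = lp_eval z p * lp_eval z q"
    using assms by (simp add: lp_eval_def sum_product power_int_add mult_ac)
  finally show ?thesis .
qed

text \<open>Multiplication by z^N turns \<open>p\<close> into a polynomial function that is
  identically zero, so all its coefficients vanish.\<close>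

lemma lp_eval_eq_0_imp:
  assumes "\<And>z. z \<noteq> 0 \<Longrightarrow> lp_eval z p = 0"
  shows "p = 0"
proof -
  \<comment> \<open>The strict inequality keeps the exponent \<open>- N\<close> out of the support.
    So \<open>a 0 = 0\<close>, and the polynomial also vanishes at 0, where nothing is assumed about
    \<open>p\<close>.\<close>
  obtain N :: nat where N: "\<bar>k\<bar> < int N" if "k \<in> lsupp p" for k
  proof -
    have "\<bar>k\<bar> < int (nat (Max (insert 0 (abs ` lsupp p))) + 1)" if "k \<in> lsupp p" for k
    proof -
      have "\<bar>k\<bar> \<le> Max (insert 0 (abs ` lsupp p))" using that by (intro Max_ge) auto
      thus ?thesis by linarith
    qed
    with that show ?thesis by blast
  qed
  define a where "a i = lcoeff p (int i - int N)" for i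
  have "(\<Sum>i\<le>2*N. a i * z ^ i) = 0" for z
  proof (cases "z = 0")
    case True
    have "a 0 = 0" using N[of "- int N"] by (auto simp: a_def in_keys_iff)
    thus ?thesis using True by (intro sum.neutral) (auto simp: power_0_left)
  next
    case False
    have "(\<Sum>i\<le>2*N. a i * z ^ i) = (\<Sum>k\<in>{- int N..int N}. lcoeff p k * z powi k * z ^ N)"
    proof (rule sum.reindex_bij_witness[of _ "\<lambda>k. nat (k + int N)" "\<lambda>i. int i - int N"])
      fix i assume "i \<in> {..2 * N}"
      have "z powi (int i - int N) * z ^ N = z powi (int i - int N + int N)"
        using False by (subst power_int_add) auto
      thus "lcoeff p (int i - int N) * z powi (int i - int N) * z ^ N = a i * z ^ i"
        by (simp add: a_def mult.assoc)
    qed auto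
    also have "\<dots> = lp_eval z p * z ^ N"
    proof -
      have "lsupp p \<subseteq> {- int N..int N}" using N by fastforce
      thus ?thesis by (simp add: lp_eval_superset[of "{- int N..int N}"] sum_distrib_right)
    qed
    finally show ?thesis using assms[OF False] by simp
  qed
  hence a: "a i = 0" if "i \<le> 2 * N" for i using polyfun_eq_0[of a "2 * N"] that by blast
  have "lcoeff p k = 0" for k
  proof (rule ccontr)
    assume "lcoeff p k \<noteq> 0"
    hence "\<bar>k\<bar> < int N" using N by (simp add: in_keys_iff)
    hence "a (nat (k + int N)) = lcoeff p k" "nat (k + int N) \<le> 2 * N"
      by (auto simp: a_def)
    with a \<open>lcoeff p k \<noteq> 0\<close> show False by metis
  qed
  thus ?thesis by (intro poly_mapping_eqI) simp
qed

text \<open>A Laurent polynomial is determined by its values away from 0, so the pointwise identity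
  becomes one in the ring. From here on the argument is algebra without evaluation.\<close>

lemma biorthogonal_iff:
  assumes P: "P \<in> carrier_mat r s" and Q: "Q \<in> carrier_mat r s"
  shows "biorthogonal P Q \<longleftrightarrow>
    (\<forall>i<r. \<forall>k<r. (\<Sum>l<s. P $$ (i, l) * lp_star (Q $$ (k, l))) = (if i = k then 1 else 0))"
    (is "_ \<longleftrightarrow> (\<forall>i<r. \<forall>k<r. ?S i k = ?\<delta> i k)")
proof -
  have entry: "(lmat_eval z P * lmat_eval z (lmat_star Q)) $$ (i, k) = lp_eval z (?S i k)"
    if "z \<noteq> 0" "i < r" "k < r" for z i k
    using P Q that
    by (auto simp: lmat_eval_def lmat_star_def scalar_prod_def lp_eval_sum lp_eval_mult
        atLeast0LessThan)
  have "biorthogonal P Q \<longleftrightarrow>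
      (\<forall>z. z \<noteq> 0 \<longrightarrow> (\<forall>i<r. \<forall>k<r. lp_eval z (?S i k) = lp_eval z (?\<delta> i k)))"
  proof -
    have "lmat_eval z P * lmat_eval z (lmat_star Q) = 1\<^sub>m r \<longleftrightarrow>
        (\<forall>i<r. \<forall>k<r. lp_eval z (?S i k) = lp_eval z (?\<delta> i k))" if z: "z \<noteq> 0" for z
    proof
      assume eq: "lmat_eval z P * lmat_eval z (lmat_star Q) = 1\<^sub>m r"
      show "\<forall>i<r. \<forall>k<r. lp_eval z (?S i k) = lp_eval z (?\<delta> i k)"
      proof (intro allI impI)
        fix i k assume "i < r" "k < r"
        thus "lp_eval z (?S i k) = lp_eval z (?\<delta> i k)"
          using entry[OF z, of i k] unfolding eq by (cases "i = k") simp_all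
      qed
    next
      assume "\<forall>i<r. \<forall>k<r. lp_eval z (?S i k) = lp_eval z (?\<delta> i k)"
      thus "lmat_eval z P * lmat_eval z (lmat_star Q) = 1\<^sub>m r"
        using entry[OF z] P Q
        by (intro eq_matI) (auto simp: lmat_eval_def lmat_star_def)
    qed
    thus ?thesis using P by (auto simp: biorthogonal_def)
  qed
  also have "\<dots> \<longleftrightarrow> (\<forall>i<r. \<forall>k<r. \<forall>z. z \<noteq> 0 \<longrightarrow> lp_eval z (?S i k) = lp_eval z (?\<delta> i k))"
    by blast
  also have "\<dots> \<longleftrightarrow> (\<forall>i<r. \<forall>k<r. ?S i k = ?\<delta> i k)"
  proof -
    have "f = g" if "\<forall>z. z \<noteq> 0 \<longrightarrow> lp_eval z f = lp_eval z g" for f g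
    proof -
      have "lp_eval z (f - g) = 0" if "z \<noteq> 0" for z
        using lp_eval_add[of z "f - g" g] \<open>\<forall>z. z \<noteq> 0 \<longrightarrow> lp_eval z f = lp_eval z g\<close> that by simp
      from lp_eval_eq_0_imp[OF this] show ?thesis by simp
    qed
    hence "(\<forall>z. z \<noteq> 0 \<longrightarrow> lp_eval z f = lp_eval z g) \<longleftrightarrow> f = g" for f g by blast
    thus ?thesis by (simp only:)
  qed
  finally show ?thesis .
qed

lemma lp_star_lp_star [simp]: "lp_star (lp_star p) = p"
  by (rule poly_mapping_eqI) (simp add: lcoeff_lp_star)

lemma lp_star_monom: "lp_star (lmonom c a) = lmonom (- c) (cnj a)"
  by (rule poly_mapping_eqI) (auto simp: lcoeff_lp_star lookup_single when_def)

lemma csupp_len_nonzero: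
  assumes "f \<noteq> 0"
  shows "0 \<le> Max (lsupp f) - Min (lsupp f)" "csupp_len f = ereal (of_int (Max (lsupp f) - Min (lsupp f)))"
proof -
  obtain k where "k \<in> lsupp f" using assms by fastforce
  hence "Min (lsupp f) \<le> k" "k \<le> Max (lsupp f)" by simp_all
  thus "0 \<le> Max (lsupp f) - Min (lsupp f)" by simp
qed (use assms in \<open>simp add: csupp_len_def\<close>)

text \<open>A nonzero entry keeps the maximum away from minus infinity, so the length bounds can be
  carried as integers.\<close>

lemma max_csupp_len_integer:
  assumes P: "P \<in> carrier_mat r s" and nz: "i0 < r" "l0 < s" "P $$ (i0, l0) \<noteq> 0"
  obtains L :: int where "0 \<le> L" "max_csupp_len P = ereal (of_int L)"
    "\<And>i l. i < r \<Longrightarrow> l < s \<Longrightarrow> csupp_len (P $$ (i, l)) \<le> ereal (of_int L)"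
proof -
  define S where "S = {csupp_len (P $$ (i, l)) | i l. i < r \<and> l < s}"
  have "S = (\<lambda>(i, l). csupp_len (P $$ (i, l))) ` ({..<r} \<times> {..<s})" by (auto simp: S_def)
  hence fin: "finite S" by simp
  have mem: "csupp_len (P $$ (i, l)) \<in> S" if "i < r" "l < s" for i l
    using that by (auto simp: S_def)
  have max: "max_csupp_len P = Max S" using P by (simp add: max_csupp_len_def S_def)
  have "0 \<le> csupp_len (P $$ (i0, l0))"
    using csupp_len_nonzero[OF nz(3)] by simp
  also have "\<dots> \<le> Max S" using fin mem nz by (intro Max_ge) auto
  finally have ge: "0 \<le> Max S" .
  have "Max S \<in> S" using fin mem nz by (intro Max_in) auto
  then obtain i l where il: "Max S = csupp_len (P $$ (i, l))" by (auto simp: S_def)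
  hence "P $$ (i, l) \<noteq> 0" using ge by (auto simp: csupp_len_def)
  with csupp_len_nonzero[OF this] max fin mem il that show ?thesis
    by (metis Max_ge)
qed

lemma max_csupp_len_le:
  assumes "P \<in> carrier_mat r s" "0 < r" "0 < s"
    and "\<And>i l. i < r \<Longrightarrow> l < s \<Longrightarrow> csupp_len (P $$ (i, l)) \<le> B"
  shows "max_csupp_len P \<le> B"
proof -
  have "{csupp_len (P $$ (i, l)) | i l. i < r \<and> l < s} =
      (\<lambda>(i, l). csupp_len (P $$ (i, l))) ` ({..<r} \<times> {..<s})" by auto
  thus ?thesis
    using assms unfolding max_csupp_len_def by (subst Max_le_iff) auto
qed

section \<open>Symmetric Laurent polynomials of bounded length\<close>

locale coefficient_field =
  fixes K :: "complex set"
  assumes K: "complex_subfield K"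
begin

lemma K_closed:
  "0 \<in> K" "1 \<in> K" "x \<in> K \<Longrightarrow> y \<in> K \<Longrightarrow> x + y \<in> K" "x \<in> K \<Longrightarrow> y \<in> K \<Longrightarrow> x * y \<in> K"
  "x \<in> K \<Longrightarrow> - x \<in> K" "x \<in> K \<Longrightarrow> inverse x \<in> K"
  "x \<in> K \<Longrightarrow> y \<in> K \<Longrightarrow> x / y \<in> K"
  using K unfolding complex_subfield_def divide_inverse by blast+

lemma K_sum: "(\<And>i. i \<in> A \<Longrightarrow> f i \<in> K) \<Longrightarrow> sum f A \<in> K"
  by (induction A rule: infinite_finite_induct) (auto intro: K_closed)

text \<open>Symmetry type \<open>S f = e z^c\<close> with \<open>|csupp f| \<le> d\<close>: by the symmetry the support is centred
  at \<open>c / 2\<close>, so it suffices to bound it from above.\<close>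

definition homog :: "complex \<Rightarrow> int \<Rightarrow> int \<Rightarrow> laurent set" where
  "homog e c d = {f. \<forall>k. lcoeff f (c - k) = e * lcoeff f k \<and>
     (lcoeff f k \<noteq> 0 \<longrightarrow> 2 * k - c \<le> d) \<and> lcoeff f k \<in> K}"

lemma homog_0 [simp, intro]: "0 \<in> homog e c d"
  by (simp add: homog_def K_closed)

lemma homog_add: "f \<in> homog e c d \<Longrightarrow> g \<in> homog e c d \<Longrightarrow> f + g \<in> homog e c d"
  unfolding homog_def mem_Collect_eq lookup_add distrib_left
  by (metis K_closed(3) add_0)

lemma homog_uminus: "f \<in> homog e c d \<Longrightarrow> - f \<in> homog e c d"
  by (auto simp: homog_def intro: K_closed)

lemma homog_diff: "f \<in> homog e c d \<Longrightarrow> g \<in> homog e c d \<Longrightarrow> f - g \<in> homog e c d"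
  using homog_add[OF _ homog_uminus] by fastforce

lemma homog_sum: "(\<And>i. i \<in> A \<Longrightarrow> f i \<in> homog e c d) \<Longrightarrow> sum f A \<in> homog e c d"
  by (induction A rule: infinite_finite_induct) (auto intro: homog_add)

lemma homog_mono: "f \<in> homog e c d \<Longrightarrow> d \<le> d' \<Longrightarrow> f \<in> homog e c d'"
  by (fastforce simp: homog_def)

lemma homog_mult:
  assumes f: "f \<in> homog e c d" and g: "g \<in> homog e' c' d'"
  shows "f * g \<in> homog (e * e') (c + c') (d + d')"
proof -
  have "lcoeff (f * g) (c + c' - n) = e * e' * lcoeff (f * g) n" for n
  proof -
    have refl: "c - k \<in> lsupp f" if "k \<in> lsupp f" for k
    proof -
      have "lcoeff f (c - (c - k)) = e * lcoeff f (c - k)"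
        using f unfolding homog_def by blast
      with that show ?thesis by (auto simp: in_keys_iff)
    qed
    have "lcoeff (f * g) (c + c' - n) = (\<Sum>k\<in>lsupp f. lcoeff f k * lcoeff g (c + c' - n - k))"
      by (rule lcoeff_mult)
    also have "\<dots> = (\<Sum>j\<in>lsupp f. lcoeff f (c - j) * lcoeff g (c' - (n - j)))"
      by (rule sum.reindex_bij_witness[of _ "\<lambda>k. c - k" "\<lambda>k. c - k"])
        (auto simp: refl algebra_simps)
    also have "\<dots> = (\<Sum>j\<in>lsupp f. e * e' * (lcoeff f j * lcoeff g (n - j)))"
    proof (rule sum.cong[OF HOL.refl])
      fix j
      have "lcoeff f (c - j) = e * lcoeff f j" "lcoeff g (c' - (n - j)) = e' * lcoeff g (n - j)"
        using f g unfolding homog_def by blast+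
      thus "lcoeff f (c - j) * lcoeff g (c' - (n - j)) = e * e' * (lcoeff f j * lcoeff g (n - j))"
        by simp
    qed
    finally show ?thesis by (simp add: lcoeff_mult sum_distrib_left)
  qed
  moreover have "2 * n - (c + c') \<le> d + d'" if "lcoeff (f * g) n \<noteq> 0" for n
  proof -
    have "\<exists>k. lcoeff f k * lcoeff g (n - k) \<noteq> 0"
      using that unfolding lcoeff_mult by (rule contrapos_np) (auto intro!: sum.neutral)
    then obtain k where "lcoeff f k * lcoeff g (n - k) \<noteq> 0" by blast
    hence "2 * k - c \<le> d" "2 * (n - k) - c' \<le> d'"
      using f g unfolding homog_def by auto
    thus ?thesis by simp
  qed
  moreover have "lcoeff (f * g) n \<in> K" for n
    unfolding lcoeff_mult using f g by (intro K_sum K_closed(4)) (auto simp: homog_def)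
  ultimately show ?thesis unfolding homog_def by blast
qed

lemma homog_monom_mult:
  assumes "f \<in> homog e c d" "a \<in> K"
  shows "lmonom m a * f \<in> homog e (c + 2 * m) d"
proof -
  have "lcoeff f (c + 2 * m - k - m) = e * lcoeff f (k - m)" for k
  proof -
    have "lcoeff f (c - (k - m)) = e * lcoeff f (k - m)" using assms unfolding homog_def by blast
    thus ?thesis by (simp add: algebra_simps)
  qed
  moreover have "2 * k - (c + 2 * m) \<le> d" if "lcoeff f (k - m) \<noteq> 0" for k
  proof -
    have "2 * (k - m) - c \<le> d" using that assms unfolding homog_def by blast
    thus ?thesis by simp
  qed
  ultimately show ?thesis
    using assms by (auto simp: homog_def lcoeff_monom_mult intro: K_closed)
qed

lemma homog_1: "0 \<le> d \<Longrightarrow> 1 \<in> homog 1 0 d"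
  by (auto simp: homog_def lookup_one when_def K_closed)

text \<open>An exponent and its mirror image both satisfy the bound, and \<open>2 * k - c\<close>
  changes sign between them.\<close>

lemma homog_nonzero_len: "f \<in> homog e c d \<Longrightarrow> f \<noteq> 0 \<Longrightarrow> 0 \<le> d"
proof -
  assume f: "f \<in> homog e c d" and "f \<noteq> 0"
  then obtain k where k: "lcoeff f k \<noteq> 0"
    by (metis lookup_zero poly_mapping_eqI)
  have "lcoeff f (c - (c - k)) = e * lcoeff f (c - k)" using f unfolding homog_def by blast
  with k have "lcoeff f (c - k) \<noteq> 0" by auto
  with k f have "2 * k - c \<le> d" "2 * (c - k) - c \<le> d" unfolding homog_def by blast+
  thus "0 \<le> d" by simp
qed

text \<open>Length 0 makes an exponent coincide with its mirror image, so it lies at the centre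
  c/2.\<close>

lemma homog_zero_len_even: "f \<in> homog e c 0 \<Longrightarrow> f \<noteq> 0 \<Longrightarrow> even c"
proof -
  assume f: "f \<in> homog e c 0" and "f \<noteq> 0"
  then obtain k where k: "lcoeff f k \<noteq> 0"
    by (metis lookup_zero poly_mapping_eqI)
  have "lcoeff f (c - (c - k)) = e * lcoeff f (c - k)" using f unfolding homog_def by blast
  with k have "lcoeff f (c - k) \<noteq> 0" by auto
  with k f have "2 * k - c \<le> 0" "2 * (c - k) - c \<le> 0" unfolding homog_def by blast+
  hence "c = 2 * k" by simp
  thus "even c" by simp
qed

text \<open>Meaningful only if \<open>c + d\<close> is even: otherwise no exponent attains the length \<open>d\<close>.\<close>

definition top_coeff :: "int \<Rightarrow> int \<Rightarrow> laurent \<Rightarrow> complex" where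
  "top_coeff c d f = lcoeff f ((c + d) div 2)"

lemma top_coeff_add: "top_coeff c d (f + g) = top_coeff c d f + top_coeff c d g"
  and top_coeff_diff: "top_coeff c d (f - g) = top_coeff c d f - top_coeff c d g"
  and top_coeff_sum: "top_coeff c d (sum h A) = (\<Sum>i\<in>A. top_coeff c d (h i))"
  by (simp_all add: top_coeff_def lookup_add lookup_minus Poly_Mapping.lookup_sum)

lemma top_coeff_K: "f \<in> homog e c d \<Longrightarrow> top_coeff c' d' f \<in> K"
  by (auto simp: homog_def top_coeff_def)

text \<open>The numbers \<open>2 * k - c\<close> all have the parity of \<open>d\<close>, so below
  \<open>d\<close> the next attainable length is \<open>d - 2\<close>.\<close>

lemma homog_drop:
  assumes f: "f \<in> homog e c d" and "even (c + d)" "top_coeff c d f = 0"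
  shows "f \<in> homog e c (d - 2)"
proof -
  have "2 * k - c \<le> d - 2" if "lcoeff f k \<noteq> 0" for k
  proof -
    have "2 * k - c \<le> d" using f that unfolding homog_def by blast
    moreover have "(c + d) div 2 \<noteq> k" using assms(3) that by (auto simp: top_coeff_def)
    ultimately show ?thesis using assms(2) by presburger
  qed
  with f show ?thesis unfolding homog_def by blast
qed

lemma top_coeff_beyond:
  assumes f: "f \<in> homog e c d" and "even (c + d)" "d < d'" "even (c + d')"
  shows "top_coeff c d' f = 0"
proof (rule ccontr)
  assume "top_coeff c d' f \<noteq> 0"
  hence "2 * ((c + d') div 2) - c \<le> d" using f unfolding homog_def top_coeff_def by blast
  with assms show False by presburger
qed

text \<open>For any other pair of exponents with the same sum, one of the two exceeds the bound of
  its factor.\<close>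

lemma top_coeff_mult:
  assumes f: "f \<in> homog e c d" and g: "g \<in> homog e' c' d'" and "even (c + d)" "even (c' + d')"
  shows "top_coeff (c + c') (d + d') (f * g) = top_coeff c d f * top_coeff c' d' g"
proof -
  define k0 where "k0 = (c + d) div 2"
  define n where "n = (c + c' + (d + d')) div 2"
  obtain x y where xy: "c + d = 2 * x" "c' + d' = 2 * y"
    using assms(3,4) by (elim evenE)
  hence "c + c' + (d + d') = 2 * (x + y)" by simp
  hence "n = x + y" unfolding n_def by (simp only:) simp
  with xy have n: "n - k0 = (c' + d') div 2" and 2: "2 * n = c + c' + d + d'"
    by (auto simp: k0_def)
  have "lcoeff f k * lcoeff g (n - k) = 0" if "k \<noteq> k0" for k
  proof (rule ccontr)
    assume "\<not> ?thesis"
    hence "2 * k - c \<le> d" "2 * (n - k) - c' \<le> d'"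
      using f g unfolding homog_def by auto
    hence "2 * k \<le> c + d" "c + d \<le> 2 * k" using 2 by auto
    hence "2 * k = c + d" by simp
    thus False using that unfolding k0_def by simp
  qed
  hence "lcoeff (f * g) n = (\<Sum>k\<in>lsupp f. if k = k0 then lcoeff f k0 * lcoeff g (n - k0) else 0)"
    unfolding lcoeff_mult by (intro sum.cong) auto
  also have "\<dots> = lcoeff f k0 * lcoeff g (n - k0)"
    by (auto simp: in_keys_iff)
  finally show ?thesis
    unfolding top_coeff_def n_def[symmetric] k0_def[symmetric] n .
qed

text \<open>The witness is a monomial plus \<open>e\<close> times its mirror image. At
  \<open>d = 0\<close> both sit at c/2, where the sign -1 admits only the zero polynomial; this
  exception is what later forces the mixing of columns.\<close>

lemma ex_homog_monic:
  assumes "even (c + d)" "0 < d \<or> d = 0 \<and> e = 1" "e \<in> {-1, 1}"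
  shows "\<exists>m \<in> homog e c d. top_coeff c d m = 1"
proof (cases "d = 0")
  case True
  then obtain j where c: "c = 2 * j" using assms by (auto elim: evenE)
  have "lmonom j 1 \<in> homog e c d"
    using assms True by (auto simp: homog_def lookup_single when_def K_closed c)
  moreover have "top_coeff c d (lmonom j 1) = 1" using True by (simp add: top_coeff_def c)
  ultimately show ?thesis by blast
next
  case False
  define j where "j = (c + d) div 2"
  have j: "2 * j = c + d" using assms(1) unfolding j_def by simp
  let ?m = "lmonom j 1 + lmonom (c - j) e"
  have "?m \<in> homog e c d"
    using assms False j
    by (auto simp: homog_def lookup_add lookup_single when_def K_closed)
  moreover have "top_coeff c d ?m = 1"
    unfolding top_coeff_def j_def[symmetric] using False j
    by (auto simp: lookup_add lookup_single when_def)
  ultimately show ?thesis by blast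
qed

lemma top_coeff_monom_mult:
  "top_coeff (c + 2 * m) d (lmonom m a * f) = a * top_coeff c d f"
proof -
  have "(c + 2 * m + d) div 2 - m = (c + d) div 2" by presburger
  thus ?thesis by (simp add: top_coeff_def lcoeff_monom_mult)
qed

lemma homog_parity:
  assumes "f \<in> homog e c d" "odd (c + d)"
  shows "f \<in> homog e c (d - 1)"
proof -
  have "2 * k - c \<le> d - 1" if "2 * k - c \<le> d" for k
    using that assms(2) by presburger
  with assms(1) show ?thesis unfolding homog_def by blast
qed

text \<open>The mirror image of an exponent \<open>k\<close> of the support is \<open>c - k\<close>,
  so their difference \<open>2 * k - c\<close> is at most the length of the support.\<close>

lemma homogI:
  assumes sym: "\<And>k. lcoeff f (c - k) = e * lcoeff f k" and "\<And>k. lcoeff f k \<in> K"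
    and len: "csupp_len f \<le> ereal (of_int L)"
  shows "f \<in> homog e c L"
proof -
  have "2 * k - c \<le> L" if k: "lcoeff f k \<noteq> 0" for k
  proof -
    have "lcoeff f (c - k) \<noteq> 0" using k sym[of "c - k"] by auto
    with k have "k \<le> Max (lsupp f)" "Min (lsupp f) \<le> c - k" "f \<noteq> 0"
      by (auto simp: in_keys_iff intro: Max_ge Min_le)
    moreover from this have "Max (lsupp f) - Min (lsupp f) \<le> L"
      using len by (simp add: csupp_len_def del: of_int_diff)
    ultimately show ?thesis by linarith
  qed
  with assms(1,2) show ?thesis by (simp add: homog_def)
qed

lemma homog_csupp_len:
  assumes f: "f \<in> homog e c L"
  shows "csupp_len f \<le> ereal (of_int L)"
proof (cases "f = 0")
  case False
  have sym: "lcoeff f (c - k) = e * lcoeff f k" and le: "lcoeff f k \<noteq> 0 \<Longrightarrow> 2 * k - c \<le> L" for k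
    using f unfolding homog_def by blast+
  have ne: "lsupp f \<noteq> {}" using False by simp
  have "lcoeff f (Max (lsupp f)) \<noteq> 0" "lcoeff f (Min (lsupp f)) \<noteq> 0"
    using Max_in[OF finite_keys ne] Min_in[OF finite_keys ne] by (simp_all add: in_keys_iff)
  moreover from this(2) have "lcoeff f (c - Min (lsupp f)) \<noteq> 0"
    using sym[of "c - Min (lsupp f)"] by auto
  ultimately have "2 * Max (lsupp f) - c \<le> L" "2 * (c - Min (lsupp f)) - c \<le> L"
    using le by blast+
  moreover have "a - b \<le> L" if "2 * a - c \<le> L" "2 * (c - b) - c \<le> L" for a b
    using that by presburger
  ultimately have "Max (lsupp f) - Min (lsupp f) \<le> L" by blast
  thus ?thesis using False by (simp add: csupp_len_def del: of_int_diff)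
qed (simp add: csupp_len_def)

lemma homog_lp_star:
  assumes f: "f \<in> homog e c L" and e: "e \<in> {-1, 1}" and cnj: "\<And>x. x \<in> K \<Longrightarrow> cnj x \<in> K"
  shows "lp_star f \<in> homog e (- c) L"
proof -
  have sym: "lcoeff f (c - k) = e * lcoeff f k" and le: "lcoeff f k \<noteq> 0 \<Longrightarrow> 2 * k - c \<le> L"
    and K: "lcoeff f k \<in> K" for k
    using f unfolding homog_def by blast+
  have "lcoeff (lp_star f) (- c - k) = e * lcoeff (lp_star f) k" for k
    using sym[of "- k"] e by (auto simp: lcoeff_lp_star add.commute)
  moreover have "2 * k - (- c) \<le> L" if "lcoeff (lp_star f) k \<noteq> 0" for k
  proof -
    have "lcoeff f (c - (- k)) \<noteq> 0" using that e sym[of "- k"] by (auto simp: lcoeff_lp_star)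
    from le[OF this] show ?thesis by simp
  qed
  moreover have "lcoeff (lp_star f) k \<in> K" for k using K cnj by (simp add: lcoeff_lp_star)
  ultimately show ?thesis unfolding homog_def by blast
qed

lemma homog_Sop: "f \<in> homog e c L \<Longrightarrow> e \<in> {-1, 1} \<Longrightarrow> lmonom c e \<in> Sop f"
  by (simp add: lmonom_in_Sop_iff homog_def)

end

section \<open>Homogeneous changes of basis\<close>

text \<open>The index set is arbitrary because the construction is used both on all columns and on
  the joint support of one row and one column. Matrices are plain functions, of which only the
  values on \<open>I\<close> count.\<close>

locale framed_matrices = coefficient_field K for K +
  fixes I :: "'i set"
  assumes finite_I: "finite I"
begin

definition dot :: "('i \<Rightarrow> laurent) \<Rightarrow> ('i \<Rightarrow> laurent) \<Rightarrow> laurent" where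
  "dot p x = (\<Sum>i\<in>I. p i * x i)"

definition mv :: "('i \<Rightarrow> 'i \<Rightarrow> laurent) \<Rightarrow> ('i \<Rightarrow> laurent) \<Rightarrow> 'i \<Rightarrow> laurent" where
  "mv A x i = dot (A i) x"

definition vm :: "('i \<Rightarrow> laurent) \<Rightarrow> ('i \<Rightarrow> 'i \<Rightarrow> laurent) \<Rightarrow> 'i \<Rightarrow> laurent" where
  "vm p A k = dot p (\<lambda>j. A j k)"

definition mm :: "('i \<Rightarrow> 'i \<Rightarrow> laurent) \<Rightarrow> ('i \<Rightarrow> 'i \<Rightarrow> laurent) \<Rightarrow> 'i \<Rightarrow> 'i \<Rightarrow> laurent" where
  "mm A B i k = dot (A i) (\<lambda>j. B j k)"

definition idm :: "'i \<Rightarrow> 'i \<Rightarrow> laurent" where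
  "idm i k = (if i = k then 1 else 0)"

definition inverse_pair :: "('i \<Rightarrow> 'i \<Rightarrow> laurent) \<Rightarrow> ('i \<Rightarrow> 'i \<Rightarrow> laurent) \<Rightarrow> bool" where
  "inverse_pair A B \<longleftrightarrow> (\<forall>i\<in>I. \<forall>k\<in>I. mm A B i k = idm i k \<and> mm B A i k = idm i k)"

lemma dot_assoc: "dot (\<lambda>k. dot p (\<lambda>j. A j k)) x = dot p (\<lambda>j. dot (A j) x)"
proof -
  have "dot (\<lambda>k. dot p (\<lambda>j. A j k)) x = (\<Sum>k\<in>I. \<Sum>j\<in>I. p j * A j k * x k)"
    by (simp add: dot_def sum_distrib_right)
  also have "\<dots> = (\<Sum>j\<in>I. \<Sum>k\<in>I. p j * A j k * x k)"
    by (rule sum.swap)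
  also have "\<dots> = dot p (\<lambda>j. dot (A j) x)"
    by (simp add: dot_def sum_distrib_left mult.assoc)
  finally show ?thesis .
qed

lemma dot_cong: "(\<And>i. i \<in> I \<Longrightarrow> p i = q i) \<Longrightarrow> (\<And>i. i \<in> I \<Longrightarrow> x i = y i) \<Longrightarrow> dot p x = dot q y"
  by (simp add: dot_def)

lemma dot_idm: "i \<in> I \<Longrightarrow> dot (idm i) x = x i" "i \<in> I \<Longrightarrow> dot x (\<lambda>j. idm j i) = x i"
  using finite_I by (simp_all add: dot_def idm_def if_distrib[of "\<lambda>a. a * _"] if_distrib[of "\<lambda>a. _ * a"]
      cong: if_cong)

lemma dot_linear:
  "dot p (\<lambda>i. x i + y i) = dot p x + dot p y" "dot p (\<lambda>i. x i - y i) = dot p x - dot p y"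
  "dot p (\<lambda>i. x i * a) = dot p x * a" "dot p (\<lambda>i. a * x i) = a * dot p x"
  "dot (\<lambda>i. x i + y i) p = dot x p + dot y p" "dot (\<lambda>i. x i - y i) p = dot x p - dot y p"
  "dot (\<lambda>i. x i * a) p = dot x p * a" "dot (\<lambda>i. a * x i) p = a * dot x p"
  by (simp_all add: dot_def distrib_left distrib_right sum.distrib left_diff_distrib
      right_diff_distrib sum_subtractf sum_distrib_left sum_distrib_right mult_ac)

lemma dot_vm: "dot (vm p A) x = dot p (mv A x)"
  unfolding vm_def mv_def by (rule dot_assoc)

lemma mv_mm: "mv (mm A B) x = mv A (mv B x)"
  unfolding mv_def mm_def fun_eq_iff by (simp add: dot_assoc)

lemma vm_mm: "vm p (mm A B) = vm (vm p A) B"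
  unfolding vm_def mm_def fun_eq_iff by (simp add: dot_assoc)

lemma mm_assoc: "mm (mm A B) C = mm A (mm B C)"
  unfolding mm_def fun_eq_iff by (simp add: dot_assoc)

lemma mm_cong:
  "(\<And>j. j \<in> I \<Longrightarrow> A i j = A' i j) \<Longrightarrow> (\<And>j. j \<in> I \<Longrightarrow> B j k = B' j k) \<Longrightarrow> mm A B i k = mm A' B' i k"
  unfolding mm_def by (intro dot_cong) auto

lemma mm_idm: "i \<in> I \<Longrightarrow> mm idm A i k = A i k" "k \<in> I \<Longrightarrow> mm A idm i k = A i k"
  by (simp_all add: mm_def dot_idm)

lemma inverse_pair_sym: "inverse_pair A B \<Longrightarrow> inverse_pair B A"
  by (simp add: inverse_pair_def)

lemma inverse_pair_mv: "inverse_pair A B \<Longrightarrow> i \<in> I \<Longrightarrow> mv A (mv B x) i = x i"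
proof -
  assume "inverse_pair A B" "i \<in> I"
  have "mv A (mv B x) i = mv (mm A B) x i" by (simp add: mv_mm)
  also have "\<dots> = dot (idm i) x"
    unfolding mv_def using \<open>inverse_pair A B\<close> \<open>i \<in> I\<close> by (intro dot_cong) (auto simp: inverse_pair_def)
  finally show ?thesis using \<open>i \<in> I\<close> by (simp add: dot_idm)
qed

lemma inverse_pair_idm: "inverse_pair idm idm"
  by (simp add: inverse_pair_def mm_idm)

lemma inverse_pair_mm:
  assumes "inverse_pair A B" "inverse_pair C D"
  shows "inverse_pair (mm A C) (mm D B)"
proof -
  have *: "mm (mm A C) (mm D B) i k = idm i k"
    if "inverse_pair A B" "inverse_pair C D" "i \<in> I" "k \<in> I" for A B C D i k
  proof -
    have *: "mm (mm C D) B j k = B j k" if "j \<in> I" for j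
    proof -
      have "mm (mm C D) B j k = mm idm B j k"
        using \<open>inverse_pair C D\<close> \<open>j \<in> I\<close> unfolding inverse_pair_def by (intro mm_cong) auto
      thus ?thesis using \<open>j \<in> I\<close> by (simp add: mm_idm)
    qed
    have "mm (mm A C) (mm D B) i k = mm A (mm (mm C D) B) i k"
      by (simp add: mm_assoc)
    also have "\<dots> = mm A B i k"
      by (intro mm_cong) (auto simp: *)
    finally show ?thesis using that by (simp add: inverse_pair_def)
  qed
  show ?thesis
    unfolding inverse_pair_def
    using *[OF assms] *[OF assms(2)[THEN inverse_pair_sym] assms(1)[THEN inverse_pair_sym]] by blast
qed

text \<open>A frame assigns to the \<open>i\<close>-th coordinate the symmetry type \<open>e i z^(c i)\<close> of a covector entry
  and a weight \<open>w i\<close>; \<open>\<phi>\<close>, \<open>\<gamma>\<close>, \<open>\<delta>\<close> are the sign, the centre and the weighted length of a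
  vector.\<close>

definition framed_vec ::
  "('i \<Rightarrow> complex) \<Rightarrow> ('i \<Rightarrow> int) \<Rightarrow> ('i \<Rightarrow> int) \<Rightarrow> complex \<Rightarrow> int \<Rightarrow> int \<Rightarrow> ('i \<Rightarrow> laurent) \<Rightarrow> bool" where
  "framed_vec e c w \<phi> \<gamma> \<delta> x \<longleftrightarrow> (\<forall>i\<in>I. x i \<in> homog (e i * \<phi>) (\<gamma> - c i) (\<delta> - w i))"

definition framed_covec ::
  "('i \<Rightarrow> complex) \<Rightarrow> ('i \<Rightarrow> int) \<Rightarrow> ('i \<Rightarrow> int) \<Rightarrow> int \<Rightarrow> ('i \<Rightarrow> laurent) \<Rightarrow> bool" where
  "framed_covec e c w D p \<longleftrightarrow> (\<forall>i\<in>I. p i \<in> homog (e i) (c i) (D + w i))"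

text \<open>The parity \<open>\<kappa>\<close> synchronises the coordinates: for \<open>D\<close> of
  the same parity, the length bound of each entry of a framed covector has the parity of its centre,
  so its \<open>top_coeff\<close> is meaningful.\<close>

definition frame :: "int \<Rightarrow> ('i \<Rightarrow> complex) \<Rightarrow> ('i \<Rightarrow> int) \<Rightarrow> ('i \<Rightarrow> int) \<Rightarrow> bool" where
  "frame \<kappa> e c w \<longleftrightarrow> (\<forall>i\<in>I. e i \<in> {-1, 1} \<and> even (w i + c i + \<kappa>))"

lemma sign_cancel: "a \<in> {-1, 1::complex} \<Longrightarrow> b * a * (a * c) = b * c" "a \<in> {-1, 1::complex} \<Longrightarrow> a * (a * b) = b"
  by auto

lemma homog_dot:
  assumes "frame \<kappa> e c w" "framed_covec e c w D p" "framed_vec e c w \<phi> \<gamma> \<delta> x"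
  shows "dot p x \<in> homog \<phi> \<gamma> (D + \<delta>)"
  unfolding dot_def
proof (rule homog_sum)
  fix i assume "i \<in> I"
  hence "p i * x i \<in> homog (e i * (e i * \<phi>)) (c i + (\<gamma> - c i)) (D + w i + (\<delta> - w i))"
    using assms by (intro homog_mult) (auto simp: framed_covec_def framed_vec_def)
  thus "p i * x i \<in> homog \<phi> \<gamma> (D + \<delta>)"
    using assms(1) \<open>i \<in> I\<close> by (simp add: sign_cancel frame_def)
qed

lemma framed_vec_mv:
  assumes "frame \<kappa> f d b" "\<And>i. i \<in> I \<Longrightarrow> framed_vec e c w (f i) (d i) (b i) (\<lambda>l. G l i)"
    and "framed_vec f d b \<phi> \<gamma> \<delta> x"
  shows "framed_vec e c w \<phi> \<gamma> \<delta> (mv G x)"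
  unfolding framed_vec_def mv_def dot_def
proof (intro ballI homog_sum)
  fix l i assume "l \<in> I" "i \<in> I"
  hence "G l i * x i \<in> homog (e l * f i * (f i * \<phi>)) (d i - c l + (\<gamma> - d i)) (b i - w l + (\<delta> - b i))"
    using assms by (intro homog_mult) (auto simp: framed_vec_def)
  moreover have "f i \<in> {-1, 1}" using assms(1) \<open>i \<in> I\<close> by (simp add: frame_def)
  ultimately show "G l i * x i \<in> homog (e l * \<phi>) (\<gamma> - c l) (\<delta> - w l)"
    by (simp add: sign_cancel)
qed

lemma framed_covec_vm:
  assumes "frame \<kappa> e c w" "framed_covec e c w D p"
    and "\<And>i. i \<in> I \<Longrightarrow> framed_vec e c w (f i) (d i) (b i) (\<lambda>l. G l i)"
  shows "framed_covec f d b D (vm p G)"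
  using homog_dot[OF assms(1,2) assms(3)] by (simp add: framed_covec_def vm_def)

text \<open>The last conjunct says that the columns of \<open>G\<close> have no cancellation in their leading
  coefficients, apart from what \<open>p\<close> detects.\<close>

definition reduction where
  "reduction \<kappa> p e c w D G H f d b \<longleftrightarrow> frame \<kappa> f d b \<and> inverse_pair G H \<and>
     (\<forall>i\<in>I. framed_vec e c w (f i) (d i) (b i) (\<lambda>l. G l i)) \<and>
     framed_covec f d b D (vm p G) \<and>
     (\<forall>x \<phi> \<gamma> \<delta>. \<phi> \<in> {-1, 1} \<longrightarrow> even (\<delta> + \<gamma> + \<kappa>) \<longrightarrow> framed_vec e c w \<phi> \<gamma> \<delta> x \<longrightarrow>
        dot p x \<in> homog \<phi> \<gamma> (D + \<delta>) \<longrightarrow> framed_vec f d b \<phi> \<gamma> \<delta> (mv H x))"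

text \<open>The first reduction gives \<open>x\<close> the coordinates \<open>mv H x\<close>, on
  which \<open>vm p G\<close> takes the value \<open>dot p x\<close>. Since
  \<open>D' \<le> D\<close>, the stronger bound for \<open>D'\<close> also implies the one that the
  first coordinate property asks for.\<close>

lemma reduction_trans:
  assumes 1: "reduction \<kappa> p e c w D G H f d b"
    and 2: "reduction \<kappa> (vm p G) f d b D' M N f' d' b'" and "D' \<le> D"
  shows "reduction \<kappa> p e c w D' (mm G M) (mm N H) f' d' b'"
  unfolding reduction_def
proof (intro conjI ballI allI impI)
  show "frame \<kappa> f' d' b'" using 2 by (simp add: reduction_def)
  show "inverse_pair (mm G M) (mm N H)"
    using 1 2 by (auto simp: reduction_def intro: inverse_pair_mm)
  show "framed_covec f' d' b' D' (vm p (mm G M))"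
    using 2 by (simp add: reduction_def vm_mm)
next
  fix i assume "i \<in> I"
  have "framed_vec e c w (f' i) (d' i) (b' i) (mv G (\<lambda>l. M l i))"
    using 1 2 \<open>i \<in> I\<close> unfolding reduction_def by (intro framed_vec_mv[where f = f and d = d and b = b]) blast+
  thus "framed_vec e c w (f' i) (d' i) (b' i) (\<lambda>l. mm G M l i)"
    by (simp add: mm_def mv_def[abs_def])
next
  fix x \<phi> \<gamma> \<delta>
  assume \<phi>: "\<phi> \<in> {-1, 1}" and \<delta>: "even (\<delta> + \<gamma> + \<kappa>)" and x: "framed_vec e c w \<phi> \<gamma> \<delta> x"
    and px: "dot p x \<in> homog \<phi> \<gamma> (D' + \<delta>)"
  have "dot p x \<in> homog \<phi> \<gamma> (D + \<delta>)"
    using px \<open>D' \<le> D\<close> by (auto intro: homog_mono)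
  hence y: "framed_vec f d b \<phi> \<gamma> \<delta> (mv H x)"
    using 1 \<phi> \<delta> x unfolding reduction_def by blast
  have "dot (vm p G) (mv H x) = dot p x"
    unfolding dot_vm using 1 by (intro dot_cong) (auto simp: reduction_def inverse_pair_mv)
  with px have "dot (vm p G) (mv H x) \<in> homog \<phi> \<gamma> (D' + \<delta>)" by simp
  with y \<phi> \<delta> have "framed_vec f' d' b' \<phi> \<gamma> \<delta> (mv N (mv H x))"
    using 2 unfolding reduction_def by blast
  thus "framed_vec f' d' b' \<phi> \<gamma> \<delta> (mv (mm N H) x)" by (simp add: mv_mm)
qed

lemma framed_vec_idm:
  assumes "frame \<kappa> e c w" "i \<in> I" "w i \<le> \<delta>"
  shows "framed_vec e c w (e i) (c i) \<delta> (\<lambda>l. idm l i)"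
  unfolding framed_vec_def
proof
  fix l assume "l \<in> I"
  have "e i * e i = 1" using assms by (auto simp: frame_def)
  thus "idm l i \<in> homog (e l * e i) (c i - c l) (\<delta> - w l)"
    using assms homog_1 by (auto simp: idm_def)
qed

text \<open>If the inverse \<open>N\<close> respects the frame as well, the coordinates keep their
  weighted length by \<open>framed_vec_mv\<close>, and no weight has to change.\<close>

lemma reduction_same_frame:
  assumes "frame \<kappa> e c w" "framed_covec e c w D p" "inverse_pair M N"
    and M: "\<And>i. i \<in> I \<Longrightarrow> framed_vec e c w (e i) (c i) (w i) (\<lambda>l. M l i)"
    and N: "\<And>i. i \<in> I \<Longrightarrow> framed_vec e c w (e i) (c i) (w i) (\<lambda>l. N l i)"
  shows "reduction \<kappa> p e c w D M N e c w"
  unfolding reduction_def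
proof (intro conjI ballI allI impI)
  show "framed_covec e c w D (vm p M)" using assms(1,2) M by (rule framed_covec_vm)
qed (use assms framed_vec_mv[OF assms(1)] in blast)+

lemma reduction_refl:
  assumes "frame \<kappa> e c w" "framed_covec e c w D p"
  shows "reduction \<kappa> p e c w D idm idm e c w"
  using assms by (intro reduction_same_frame) (auto simp: inverse_pair_idm framed_vec_idm)

section \<open>Elementary reductions of the order basis\<close>

lemma frame_even:
  assumes "frame \<kappa> f d b" "i \<in> I"
  shows "even (D + \<kappa>) \<Longrightarrow> even (d i + (D + b i))"
    and "even (\<delta> + \<gamma> + \<kappa>) \<Longrightarrow> even (\<gamma> - d i + (\<delta> - b i))"
    and "k \<in> I \<Longrightarrow> even (d k - d i + (b k - b i))"
proof -
  have e: "even (b j + d j + \<kappa>)" if "j \<in> I" for j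
    using assms(1) that unfolding frame_def by blast
  have *: "even (D + \<kappa>) \<Longrightarrow> even (x + y + \<kappa>) \<Longrightarrow> even (y + (D + x))"
    "even (\<delta> + \<gamma> + \<kappa>) \<Longrightarrow> even (x + y + \<kappa>) \<Longrightarrow> even (\<gamma> - y + (\<delta> - x))"
    "even (z + w + \<kappa>) \<Longrightarrow> even (x + y + \<kappa>) \<Longrightarrow> even (w - y + (z - x))" for x y z w :: int
    by presburger+
  show "even (D + \<kappa>) \<Longrightarrow> even (d i + (D + b i))"
    and "even (\<delta> + \<gamma> + \<kappa>) \<Longrightarrow> even (\<gamma> - d i + (\<delta> - b i))"
    and "k \<in> I \<Longrightarrow> even (d k - d i + (b k - b i))"
    using *[OF _ e[OF assms(2)]] e by blast+
qed

lemma top_coeff_dot: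
  assumes "frame \<kappa> f d b" "even (D + \<kappa>)" "framed_covec f d b D p" "framed_vec f d b \<phi> \<gamma> \<delta> x"
    "even (\<delta> + \<gamma> + \<kappa>)"
  shows "top_coeff \<gamma> (D + \<delta>) (dot p x) =
    (\<Sum>k\<in>I. top_coeff (d k) (D + b k) (p k) * top_coeff (\<gamma> - d k) (\<delta> - b k) (x k))"
  unfolding dot_def top_coeff_sum
proof (rule sum.cong[OF refl])
  fix k assume k: "k \<in> I"
  have "even (d k + (D + b k))" "even (\<gamma> - d k + (\<delta> - b k))"
    using frame_even[OF assms(1) k] assms(2,5) by blast+
  from top_coeff_mult[OF _ _ this] assms(3,4) k
  show "top_coeff \<gamma> (D + \<delta>) (p k * x k) =
      top_coeff (d k) (D + b k) (p k) * top_coeff (\<gamma> - d k) (\<delta> - b k) (x k)"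
    unfolding framed_covec_def framed_vec_def by fastforce
qed

text \<open>Column \<open>i\<close> is the pivot, and a multiple of it is subtracted from every
  column of \<open>X\<close>. The condition \<open>le\<close> on weights and signs lets
  \<open>ex_homog_monic\<close> supply multipliers of the type that the frame demands.\<close>

lemma elimination:
  assumes fr: "frame \<kappa> f d b" and p: "framed_covec f d b D p"
    and i: "i \<in> I" "i \<notin> X" and X: "X \<subseteq> I"
    and nz: "top_coeff (d i) (D + b i) (p i) \<noteq> 0" and D: "even (D + \<kappa>)"
    and le: "\<And>k. k \<in> X \<Longrightarrow> b i < b k \<or> b i = b k \<and> f i = f k"
  shows "\<exists>M N. reduction \<kappa> p f d b D M N f d b \<and> (\<forall>k\<in>I - X. vm p M k = p k) \<and>
    (\<forall>k\<in>X. top_coeff (d k) (D + b k) (vm p M k) = 0)"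
proof -
  let ?t = "\<lambda>k. top_coeff (d k) (D + b k) (p k)"
  have "\<exists>m. m \<in> homog (f i * f k) (d k - d i) (b k - b i) \<and> top_coeff (d k - d i) (b k - b i) m = 1"
    if "k \<in> X" for k
  proof -
    have "f i \<in> {-1, 1}" "f k \<in> {-1, 1}"
      using fr i X that unfolding frame_def by blast+
    moreover have "even ((d k - d i) + (b k - b i))"
      using frame_even(3)[OF fr i(1)] X that by blast
    ultimately show ?thesis
      using ex_homog_monic[of "d k - d i" "b k - b i" "f i * f k"] le[OF that] by auto
  qed
  then obtain m where m: "\<And>k. k \<in> X \<Longrightarrow> m k \<in> homog (f i * f k) (d k - d i) (b k - b i)"
    "\<And>k. k \<in> X \<Longrightarrow> top_coeff (d k - d i) (b k - b i) (m k) = 1"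
    by metis
  \<comment> \<open>Since \<open>m k\<close> has leading coefficient 1, the scalar
    \<open>?t k / ?t i\<close> makes the leading coefficients cancel. As \<open>u i = 0\<close>, the
    matrix subtracted in \<open>M\<close> and added in \<open>N\<close> squares to zero, so the two
    are inverse.\<close>
  define u where "u k = (if k \<in> X then lmonom 0 (?t k / ?t i) * m k else 0)" for k
  define M where "M l k = idm l k - idm l i * u k" for l k
  define N where "N l k = idm l k + idm l i * u k" for l k
  have tK: "?t k \<in> K" if "k \<in> I" for k
    using p that unfolding framed_covec_def by (blast intro: top_coeff_K)
  have u: "u k \<in> homog (f i * f k) (d k - d i) (b k - b i)" if "k \<in> I" for k
    using homog_monom_mult[OF m(1), of k "?t k / ?t i" 0] tK i that
    by (auto simp: u_def intro: K_closed)
  have ui: "u i = 0" using i by (simp add: u_def)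
  have "inverse_pair M N"
    unfolding inverse_pair_def mm_def M_def N_def
    using i(1) by (auto simp: dot_linear dot_idm ui)
  moreover have "framed_vec f d b (f k) (d k) (b k) (\<lambda>l. idm l i * u k)" if "k \<in> I" for k
    using u[OF that] by (auto simp: framed_vec_def idm_def)
  hence "framed_vec f d b (f k) (d k) (b k) (\<lambda>l. M l k)"
    "framed_vec f d b (f k) (d k) (b k) (\<lambda>l. N l k)" if "k \<in> I" for k
    using framed_vec_idm[OF fr that order_refl] that unfolding M_def N_def framed_vec_def
    by (auto intro: homog_add homog_diff)
  ultimately have "reduction \<kappa> p f d b D M N f d b"
    using fr p by (intro reduction_same_frame) auto
  moreover have vm: "vm p M k = p k - p i * u k" if "k \<in> I" for k
    using i(1) that by (simp add: vm_def M_def dot_linear dot_idm)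
  moreover have "top_coeff (d k) (D + b k) (vm p M k) = 0" if "k \<in> X" for k
  proof -
    have k: "k \<in> I" using that X by blast
    have ev: "even (d i + (D + b i))" "even (d k - d i + (b k - b i))"
      using frame_even[OF fr i(1)] k D by blast+
    have "top_coeff (d i + (d k - d i)) (D + b i + (b k - b i)) (p i * u k) = ?t i * top_coeff (d k - d i) (b k - b i) (u k)"
      using p i(1) k u ev unfolding framed_covec_def by (intro top_coeff_mult) blast+
    moreover have "top_coeff (d k - d i) (b k - b i) (u k) = ?t k / ?t i"
      using top_coeff_monom_mult[of "d k - d i" 0 "b k - b i" "?t k / ?t i" "m k"] m(2)[OF that] that
      by (simp add: u_def)
    ultimately show ?thesis using nz by (simp add: vm[OF k] top_coeff_diff)
  qed
  ultimately show ?thesis by (intro exI[of _ M] exI[of _ N]) (auto simp: u_def)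
qed

lemma framed_covec_drop:
  assumes "frame \<kappa> f d b" "even (D + \<kappa>)" "framed_covec f d b D p"
    "i \<in> I" "top_coeff (d i) (D + b i) (p i) = 0"
  shows "p i \<in> homog (f i) (d i) (D - 2 + b i)"
proof -
  have "even (d i + (D + b i))"
    using frame_even(1)[OF assms(1,4,2)] .
  from homog_drop[OF _ this assms(5)] assms(3,4) show ?thesis
    by (auto simp: framed_covec_def algebra_simps)
qed

text \<open>The coefficient of \<open>dot p x\<close> at length \<open>D + \<delta>\<close> is the
  leading coefficient of \<open>p i\<close> times that of \<open>x i\<close>. If the product is
  shorter, \<open>x i\<close> has lost its leading term, which pays for the larger weight of
  coordinate \<open>i\<close>.\<close>

lemma raise_weight:
  assumes fr: "frame \<kappa> f d b" and D: "even (D + \<kappa>)" and p: "framed_covec f d b D p" and i: "i \<in> I"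
    and nz: "top_coeff (d i) (D + b i) (p i) \<noteq> 0"
    and z: "\<And>k. k \<in> I \<Longrightarrow> k \<noteq> i \<Longrightarrow> top_coeff (d k) (D + b k) (p k) = 0"
  shows "reduction \<kappa> p f d b (D - 2) idm idm f d (b(i := b i + 2))"
  unfolding reduction_def
proof (intro conjI ballI allI impI)
  show "frame \<kappa> f d (b(i := b i + 2))"
    using fr by (auto simp: frame_def)
  show "inverse_pair idm idm" by (rule inverse_pair_idm)
  show "framed_vec f d b (f k) (d k) ((b(i := b i + 2)) k) (\<lambda>l. idm l k)" if "k \<in> I" for k
    using that by (intro framed_vec_idm[OF fr]) auto
  have "p k \<in> homog (f k) (d k) (D - 2 + (b(i := b i + 2)) k)" if "k \<in> I" for k
    using framed_covec_drop[OF fr D p that z[OF that]] p that by (auto simp: framed_covec_def)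
  thus "framed_covec f d (b(i := b i + 2)) (D - 2) (vm p idm)"
    by (simp add: framed_covec_def vm_def dot_idm)
next
  fix x \<phi> \<gamma> \<delta>
  assume ev: "even (\<delta> + \<gamma> + \<kappa>)" and x: "framed_vec f d b \<phi> \<gamma> \<delta> x"
    and px: "dot p x \<in> homog \<phi> \<gamma> (D - 2 + \<delta>)"
  have "top_coeff \<gamma> (D + \<delta>) (dot p x) = 0"
    using px ev D by (intro top_coeff_beyond[OF px]) presburger+
  also have "top_coeff \<gamma> (D + \<delta>) (dot p x) =
      (\<Sum>k\<in>{i}. top_coeff (d k) (D + b k) (p k) * top_coeff (\<gamma> - d k) (\<delta> - b k) (x k))"
    unfolding top_coeff_dot[OF fr D p x ev] using i z finite_I by (intro sum.mono_neutral_right) auto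
  finally have "top_coeff (\<gamma> - d i) (\<delta> - b i) (x i) = 0" using nz by simp
  moreover have "even (\<gamma> - d i + (\<delta> - b i))"
    using frame_even(2)[OF fr i ev] .
  ultimately have "x i \<in> homog (f i * \<phi>) (\<gamma> - d i) (\<delta> - (b i + 2))"
    using homog_drop[of "x i" "f i * \<phi>" "\<gamma> - d i" "\<delta> - b i"] x i
    by (auto simp: framed_vec_def algebra_simps)
  thus "framed_vec f d (b(i := b i + 2)) \<phi> \<gamma> \<delta> (mv idm x)"
    using x by (auto simp: framed_vec_def mv_def dot_idm)
qed

section \<open>Mixing two columns of equal weight and opposite sign\<close>

definition block :: "'i \<Rightarrow> 'i \<Rightarrow> laurent \<Rightarrow> laurent \<Rightarrow> laurent \<Rightarrow> laurent \<Rightarrow> 'i \<Rightarrow> 'i \<Rightarrow> laurent" where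
  "block i j a11 a12 a21 a22 l k =
     (if l = i then if k = i then a11 else if k = j then a12 else 0
      else if l = j then if k = i then a21 else if k = j then a22 else 0
      else idm l k)"

lemma dot_support2:
  assumes "i \<in> I" "j \<in> I" "i \<noteq> j" "\<And>k. k \<in> I \<Longrightarrow> k \<noteq> i \<Longrightarrow> k \<noteq> j \<Longrightarrow> p k * x k = 0"
  shows "dot p x = p i * x i + p j * x j"
proof -
  have "dot p x = (\<Sum>k\<in>{i, j}. p k * x k)"
    unfolding dot_def using assms finite_I by (intro sum.mono_neutral_right) auto
  thus ?thesis using assms(3) by simp
qed

lemma dot_block_row:
  assumes "i \<in> I" "j \<in> I" "i \<noteq> j" "l \<in> I"
  shows "dot (block i j a11 a12 a21 a22 l) x =
    (if l = i then a11 * x i + a12 * x j else if l = j then a21 * x i + a22 * x j else x l)"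
proof (cases "l = i \<or> l = j")
  case True
  thus ?thesis using assms by (subst dot_support2[of i j]) (auto simp: block_def)
next
  case False
  have "dot (block i j a11 a12 a21 a22 l) x = dot (idm l) x"
    using False by (intro dot_cong) (auto simp: block_def)
  thus ?thesis using assms False by (simp add: dot_idm)
qed

lemma dot_block_col:
  assumes "i \<in> I" "j \<in> I" "i \<noteq> j" "k \<in> I"
  shows "dot x (\<lambda>l. block i j a11 a12 a21 a22 l k) =
    (if k = i then x i * a11 + x j * a21 else if k = j then x i * a12 + x j * a22 else x k)"
proof (cases "k = i \<or> k = j")
  case True
  thus ?thesis using assms by (subst dot_support2[of i j]) (auto simp: block_def idm_def)
next
  case False
  have "dot x (\<lambda>l. block i j a11 a12 a21 a22 l k) = dot x (\<lambda>l. idm l k)"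
    using False by (intro dot_cong) (auto simp: block_def idm_def)
  thus ?thesis using assms False by (simp add: dot_idm)
qed

lemma inverse_pair_block:
  assumes "i \<in> I" "j \<in> I" "i \<noteq> j"
    and "a11 * b11 + a12 * b21 = 1" "a11 * b12 + a12 * b22 = 0"
    and "a21 * b11 + a22 * b21 = 0" "a21 * b12 + a22 * b22 = 1"
    and "b11 * a11 + b12 * a21 = 1" "b11 * a12 + b12 * a22 = 0"
    and "b21 * a11 + b22 * a21 = 0" "b21 * a12 + b22 * a22 = 1"
  shows "inverse_pair (block i j a11 a12 a21 a22) (block i j b11 b12 b21 b22)"
  unfolding inverse_pair_def mm_def
  using assms by (auto simp: dot_block_row block_def idm_def)

text \<open>Two columns of equal weight and opposite sign cannot reduce each other, since every
  antisymmetric Laurent polynomial centred at 0 has positive length. But the matrix with rows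
  \<open>(1 + z, z - 1)\<close> and \<open>(-(z - 1), -(1 + z))\<close> has determinant \<open>-4z\<close>, a unit.\<close>

lemma mix_opposite_signs:
  assumes fr: "frame \<kappa> f d b" and D: "even (D + \<kappa>)" and p: "framed_covec f d b D p"
    and ij: "i \<in> I" "j \<in> I" "i \<noteq> j" and bij: "b i = b j" and fij: "f j = - f i"
    and nz: "top_coeff (d i) (D + b i) (p i) \<noteq> 0" "top_coeff (d j) (D + b j) (p j) \<noteq> 0"
    and z: "\<And>k. k \<in> I \<Longrightarrow> k \<noteq> i \<Longrightarrow> k \<noteq> j \<Longrightarrow> top_coeff (d k) (D + b k) (p k) = 0"
  shows "\<exists>M N. reduction \<kappa> p f d b (D - 2) M N f
    (d(i := d i + 1, j := d i + 1)) (b(i := b i + 1, j := b i + 1))"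
proof -
  let ?d = "d(i := d i + 1, j := d i + 1)" and ?b = "b(i := b i + 1, j := b i + 1)"
  define ti where "ti = top_coeff (d i) (D + b i) (p i)"
  define tj where "tj = top_coeff (d j) (D + b j) (p j)"
  have t: "ti \<noteq> 0" "tj \<noteq> 0" using nz by (simp_all add: ti_def tj_def)
  have tK: "ti \<in> K" "tj \<in> K"
    using p ij unfolding framed_covec_def ti_def tj_def by (blast intro: top_coeff_K)+
  have "(4::complex) = (1 + 1) * (1 + 1)" by simp
  hence "4 \<in> K" using K_closed by metis
  hence tK': "1 / ti \<in> K" "1 / tj \<in> K" "- (1 / tj) \<in> K" "ti / 4 \<in> K" "tj / 4 \<in> K"
      "- (ti / 4) \<in> K" "- (tj / 4) \<in> K"
    using tK by (auto intro!: K_closed)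
  have si: "f i \<in> {-1, 1}" using fr ij unfolding frame_def by blast
  \<comment> \<open>Equal weights force centres of equal parity, so a shift by z^m can align column
    \<open>j\<close> with column \<open>i\<close>.\<close>
  have "even (d i - d j)"
    using frame_even(3)[OF fr ij(2) ij(1)] bij by simp
  then obtain m where "d i - d j = 2 * m" by (rule evenE)
  hence dj: "d j = d i - 2 * m" by simp
  define A :: laurent where "A = lmonom 1 1 + lmonom 0 1"
  define B :: laurent where "B = lmonom 1 1 - lmonom 0 1"
  have A: "A \<in> homog 1 1 1" "top_coeff 1 1 A = 1"
    by (auto simp: A_def homog_def lookup_add lookup_single lookup_one when_def K_closed top_coeff_def)
  have B: "B \<in> homog (-1) 1 1" "top_coeff 1 1 B = 1"
    by (auto simp: B_def homog_def lookup_minus lookup_single lookup_one when_def K_closed top_coeff_def)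
  have AA: "A * A = B * B + lmonom 1 4"
    by (simp add: A_def B_def algebra_simps mult_single mult_2 flip: single_add single_diff)
  have mul: "lmonom x u * X * (lmonom y v * Y) = lmonom (x + y) (u * v) * (X * Y)" for x u X y v Y
    by (simp add: mult_single[symmetric] mult_ac)
  have one: "lmonom (-1) (1/4) * (B * B + lmonom 1 4) - lmonom (-1) (1/4) * (B * B) = 1"
    by (simp add: distrib_left mult_single)
  \<comment> \<open>The factors \<open>1 / ti\<close> and \<open>- (1 / tj)\<close> make both mixed
    entries of \<open>p\<close> lose their leading term. The 2x2 block of \<open>M\<close> has
    determinant -4 z^(m+1) / (ti tj), and the block of \<open>N\<close> is its adjugate divided by
    this unit.\<close>
  define M where "M = block i j (lmonom 0 (1 / ti) * A) (lmonom 0 (1 / ti) * B)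
    (lmonom m (- (1 / tj)) * B) (lmonom m (- (1 / tj)) * A)"
  define N where "N = block i j (lmonom (-1) (ti / 4) * A) (lmonom (-1 - m) (tj / 4) * B)
    (lmonom (-1) (- (ti / 4)) * B) (lmonom (-1 - m) (- (tj / 4)) * A)"
  have "inverse_pair M N"
    unfolding M_def N_def using ij t one
    by (intro inverse_pair_block)
      (simp_all add: mul AA single_uminus mult.commute[of B A] del: distrib_left)
  have evi: "even (d i + (D + b i))" and evj: "even (d j + (D + b j))"
    using frame_even(1)[OF fr _ D] ij by blast+
  have pi: "p i \<in> homog (f i) (d i) (D + b i)" and pj: "p j \<in> homog (- f i) (d j) (D + b j)"
    using p ij fij unfolding framed_covec_def by force+
  \<comment> \<open>Multiplication by \<open>A\<close> or \<open>B\<close> lengthens both terms by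
    1, and the cancellation then saves 2. The result fits \<open>D - 2\<close> with the weight
    raised by 1.\<close>
  have mixed_col: "p i * (lmonom 0 (1 / ti) * X) + p j * (lmonom m (- (1 / tj)) * Y)
      \<in> homog (f i * \<sigma>) (d i + 1) (D - 2 + (b i + 1))"
    if X: "X \<in> homog \<sigma> 1 1" "top_coeff 1 1 X = 1" and Y: "Y \<in> homog (- \<sigma>) 1 1" "top_coeff 1 1 Y = 1"
    for X Y \<sigma>
  proof -
    let ?X = "lmonom 0 (1 / ti) * X" and ?Y = "lmonom m (- (1 / tj)) * Y"
    have X': "?X \<in> homog \<sigma> (1 + 2 * 0) 1" and Y': "?Y \<in> homog (- \<sigma>) (1 + 2 * m) 1"
      using X(1) Y(1) tK' by (blast intro: homog_monom_mult)+
    have cj: "d j + (1 + 2 * m) = d i + 1" using dj by simp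
    have "p i * ?X \<in> homog (f i * \<sigma>) (d i + (1 + 2 * 0)) (D + b i + 1)"
      "p j * ?Y \<in> homog (- f i * - \<sigma>) (d j + (1 + 2 * m)) (D + b j + 1)"
      using homog_mult[OF pi X'] homog_mult[OF pj Y'] .
    hence h: "p i * ?X + p j * ?Y \<in> homog (f i * \<sigma>) (d i + 1) (D + b i + 1)"
      unfolding cj by (intro homog_add) (auto simp: bij)
    have "top_coeff (d i + (1 + 2 * 0)) (D + b i + 1) (p i * ?X) = ti * (1 / ti * 1)"
      using top_coeff_mult[OF pi X' evi] top_coeff_monom_mult[of 1 0 1 "1 / ti" X] X(2)
      by (simp add: ti_def)
    moreover have "top_coeff (d j + (1 + 2 * m)) (D + b j + 1) (p j * ?Y) = tj * (- (1 / tj) * 1)"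
      using top_coeff_mult[OF pj Y' evj] top_coeff_monom_mult[of 1 m 1 "- (1 / tj)" Y] Y(2)
      by (simp add: tj_def)
    ultimately have "top_coeff (d i + 1) (D + b i + 1) (p i * ?X + p j * ?Y) = 0"
      unfolding cj using t by (simp add: top_coeff_add bij)
    moreover have "even (d i + 1 + (D + b i + 1))" using evi by simp
    ultimately show ?thesis using homog_drop[OF h] by (simp add: algebra_simps)
  qed
  have ff: "f i * f i = 1" using si by auto
  have dj': "d i + 1 - d j = 1 + 2 * m" using dj by simp
  have blocks: "lmonom 0 (1 / ti) * A \<in> homog 1 1 1" "lmonom 0 (1 / ti) * B \<in> homog (-1) 1 1"
    "lmonom m (- (1 / tj)) * A \<in> homog 1 (1 + 2 * m) 1" "lmonom m (- (1 / tj)) * B \<in> homog (-1) (1 + 2 * m) 1"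
    using homog_monom_mult[OF A(1), of "1 / ti" 0] homog_monom_mult[OF B(1), of "1 / ti" 0]
      homog_monom_mult[OF A(1), of "- (1 / tj)" m] homog_monom_mult[OF B(1), of "- (1 / tj)" m] tK'
    by auto
  have "reduction \<kappa> p f d b (D - 2) M N f ?d ?b"
    unfolding reduction_def
  proof (intro conjI ballI allI impI)
    show "frame \<kappa> f ?d ?b"
      using fr ij unfolding frame_def by auto
    show "inverse_pair M N" by fact
    show "framed_vec f d b (f k) (?d k) (?b k) (\<lambda>l. M l k)" if "k \<in> I" for k
    proof (cases "k = i \<or> k = j")
      case True
      thus ?thesis
        using blocks ij by (auto simp: framed_vec_def M_def block_def idm_def fij ff bij dj')
    next
      case False
      have "framed_vec f d b (f k) (d k) (b k) (\<lambda>l. idm l k)"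
        using framed_vec_idm[OF fr that] by simp
      thus ?thesis
        using False by (auto simp: framed_vec_def M_def block_def idm_def)
    qed
    show "framed_covec f ?d ?b (D - 2) (vm p M)"
      unfolding framed_covec_def
    proof
      fix k assume k: "k \<in> I"
      have "vm p M k \<in> homog (f k) (d k) (D - 2 + b k)" if "k \<noteq> i" "k \<noteq> j"
        using framed_covec_drop[OF fr D p k z[OF k]] that ij k
        by (simp add: vm_def M_def dot_block_col)
      moreover have "vm p M k \<in> homog (f i) (d i + 1) (D - 2 + (b i + 1))" if "k = i"
        using mixed_col[of A 1 B] A B that ij by (simp add: vm_def M_def dot_block_col)
      moreover have "vm p M k \<in> homog (f j) (d i + 1) (D - 2 + (b i + 1))" if "k = j"
        using mixed_col[of B "-1" A] A B that ij by (simp add: vm_def M_def dot_block_col fij)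
      ultimately show "vm p M k \<in> homog (f k) (?d k) (D - 2 + ?b k)"
        using ij by auto
    qed
  next
    fix x \<phi> \<gamma> \<delta>
    assume ev: "even (\<delta> + \<gamma> + \<kappa>)" and x: "framed_vec f d b \<phi> \<gamma> \<delta> x"
      and px: "dot p x \<in> homog \<phi> \<gamma> (D - 2 + \<delta>)"
    define xi where "xi = top_coeff (\<gamma> - d i) (\<delta> - b i) (x i)"
    define xj where "xj = top_coeff (\<gamma> - d j) (\<delta> - b j) (x j)"
    have evi: "even (\<gamma> - d i + (\<delta> - b i))" and evj: "even (\<gamma> - d j + (\<delta> - b j))"
      using frame_even(2)[OF fr _ ev] ij by blast+
    have hxi: "x i \<in> homog (f i * \<phi>) (\<gamma> - d i) (\<delta> - b i)"
      and hxj: "x j \<in> homog (- f i * \<phi>) (\<gamma> - d j) (\<delta> - b j)"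
      using x ij fij unfolding framed_vec_def by force+
    \<comment> \<open>The short product gives one linear relation between the leading coefficients
      of \<open>x i\<close> and \<open>x j\<close>. It kills the leading terms of both new
      coordinates, because in each of the two rows of \<open>N\<close> the leading coefficients are
      proportional to \<open>ti\<close> and \<open>tj\<close>.\<close>
    have "top_coeff \<gamma> (D + \<delta>) (dot p x) = 0"
      using ev D by (intro top_coeff_beyond[OF px]) presburger+
    also have "top_coeff \<gamma> (D + \<delta>) (dot p x) =
        (\<Sum>k\<in>{i, j}. top_coeff (d k) (D + b k) (p k) * top_coeff (\<gamma> - d k) (\<delta> - b k) (x k))"
      unfolding top_coeff_dot[OF fr D p x ev] using ij z finite_I
      by (intro sum.mono_neutral_right) auto
    finally have rel: "ti * xi + tj * xj = 0"
      using ij by (simp add: ti_def tj_def xi_def xj_def)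
    have mixed_row: "lmonom (-1) (s * (ti / 4)) * X * x i + lmonom (-1 - m) (s * (tj / 4)) * Y * x j
        \<in> homog (f i * \<sigma> * \<phi>) (\<gamma> - (d i + 1)) (\<delta> - (b i + 1))"
      if X: "X \<in> homog \<sigma> 1 1" "top_coeff 1 1 X = 1" and Y: "Y \<in> homog (- \<sigma>) 1 1" "top_coeff 1 1 Y = 1"
        and s: "s \<in> {-1, 1}" for X Y \<sigma> s
    proof -
      let ?X = "lmonom (-1) (s * (ti / 4)) * X" and ?Y = "lmonom (-1 - m) (s * (tj / 4)) * Y"
      have "s * (ti / 4) \<in> K" "s * (tj / 4) \<in> K" using s tK' by auto
      hence X': "?X \<in> homog \<sigma> (1 + 2 * (-1)) 1" and Y': "?Y \<in> homog (- \<sigma>) (1 + 2 * (-1 - m)) 1"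
        using X(1) Y(1) by (blast intro: homog_monom_mult)+
      have c: "1 + 2 * (-1) + (\<gamma> - d i) = \<gamma> - (d i + 1)" "1 + 2 * (-1 - m) + (\<gamma> - d j) = \<gamma> - (d i + 1)"
        using dj by simp_all
      have w: "1 + (\<delta> - b i) = \<delta> - b i + 1" "1 + (\<delta> - b j) = \<delta> - b i + 1"
        using bij by simp_all
      have "?X * x i \<in> homog (\<sigma> * (f i * \<phi>)) (\<gamma> - (d i + 1)) (\<delta> - b i + 1)"
        "?Y * x j \<in> homog (- \<sigma> * (- f i * \<phi>)) (\<gamma> - (d i + 1)) (\<delta> - b i + 1)"
        using homog_mult[OF X' hxi] homog_mult[OF Y' hxj] unfolding c w .
      hence h: "?X * x i + ?Y * x j \<in> homog (f i * \<sigma> * \<phi>) (\<gamma> - (d i + 1)) (\<delta> - b i + 1)"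
        by (intro homog_add) (simp_all add: mult_ac)
      have "top_coeff (\<gamma> - (d i + 1)) (\<delta> - b i + 1) (?X * x i) = s * (ti / 4) * 1 * xi"
        using top_coeff_mult[OF X' hxi _ evi] top_coeff_monom_mult[of 1 "-1" 1 "s * (ti / 4)" X] X(2)
        unfolding c w by (simp add: xi_def)
      moreover have "top_coeff (\<gamma> - (d i + 1)) (\<delta> - b i + 1) (?Y * x j) = s * (tj / 4) * 1 * xj"
        using top_coeff_mult[OF Y' hxj _ evj] top_coeff_monom_mult[of 1 "-1 - m" 1 "s * (tj / 4)" Y] Y(2)
        unfolding c w by (simp add: xj_def)
      ultimately have "top_coeff (\<gamma> - (d i + 1)) (\<delta> - b i + 1) (?X * x i + ?Y * x j)
          = s / 4 * (ti * xi + tj * xj)"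
        by (simp only: top_coeff_add, simp add: algebra_simps)
      also have "\<dots> = 0" using rel by simp
      finally have "top_coeff (\<gamma> - (d i + 1)) (\<delta> - b i + 1) (?X * x i + ?Y * x j) = 0" .
      moreover have "even (\<gamma> - (d i + 1) + (\<delta> - b i + 1))" using evi by presburger
      ultimately show ?thesis using homog_drop[OF h] by (simp add: algebra_simps)
    qed
    show "framed_vec f ?d ?b \<phi> \<gamma> \<delta> (mv N x)"
      unfolding framed_vec_def
    proof
      fix k assume k: "k \<in> I"
      have "mv N x k \<in> homog (f k * \<phi>) (\<gamma> - d k) (\<delta> - b k)" if "k \<noteq> i" "k \<noteq> j"
        using x that ij k by (simp add: mv_def N_def dot_block_row framed_vec_def)
      moreover have "mv N x k \<in> homog (f i * \<phi>) (\<gamma> - (d i + 1)) (\<delta> - (b i + 1))" if "k = i"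
        using mixed_row[of A 1 B 1] A B that ij by (simp add: mv_def N_def dot_block_row)
      moreover have "mv N x k \<in> homog (f j * \<phi>) (\<gamma> - (d i + 1)) (\<delta> - (b i + 1))" if "k = j"
        using mixed_row[of B "-1" A "-1"] A B that ij by (simp add: mv_def N_def dot_block_row fij)
      ultimately show "mv N x k \<in> homog (f k * \<phi>) (\<gamma> - ?d k) (\<delta> - ?b k)"
        using ij by auto
    qed
  qed
  thus ?thesis by blast
qed

text \<open>If all leading coefficients vanish, the weights stay. Otherwise a pivot of least weight
  clears every column it can; the surviving others have its weight and the opposite sign. If there
  is none, the pivot's weight rises by 2. If there are some, one of them clears the others, which
  share its sign, and is then mixed with the pivot.\<close>

lemma reduction_step:
  assumes fr: "frame \<kappa> f d b" and D: "even (D + \<kappa>)" and p: "framed_covec f d b D p"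
    and b: "\<And>i. i \<in> I \<Longrightarrow> 0 \<le> b i"
  shows "\<exists>M N f' d' b'. reduction \<kappa> p f d b (D - 2) M N f' d' b' \<and> (\<forall>i\<in>I. 0 \<le> b' i) \<and>
    sum b' I \<le> sum b I + 2"
proof -
  let ?t = "\<lambda>q k. top_coeff (d k) (D + b k) (q k)"
  define S where "S = {k \<in> I. ?t p k \<noteq> 0}"
  show ?thesis
  proof (cases "S = {}")
    case True
    hence "framed_covec f d b (D - 2) p"
      unfolding framed_covec_def S_def using framed_covec_drop[OF fr D p] by blast
    from reduction_refl[OF fr this] b show ?thesis
      by (intro exI[of _ idm] exI[of _ f] exI[of _ d] exI[of _ b]) auto
  next
    case False
    have "finite S" using finite_I by (simp add: S_def)
    hence "Min (b ` S) \<in> b ` S" using False by (intro Min_in) auto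
    then obtain i where i: "i \<in> S" "b i = Min (b ` S)" by auto
    hence imin: "b i \<le> b k" if "k \<in> S" for k
      using that \<open>finite S\<close> by simp
    have iI: "i \<in> I" and it: "?t p i \<noteq> 0" using i by (auto simp: S_def)
    define X where "X = {k \<in> S - {i}. b i < b k \<or> b i = b k \<and> f i = f k}"
    have "i \<notin> X" "X \<subseteq> I" "\<And>k. k \<in> X \<Longrightarrow> b i < b k \<or> b i = b k \<and> f i = f k"
      by (auto simp: X_def S_def)
    from elimination[OF fr p iI this(1,2) it D this(3)] obtain M N where
      red: "reduction \<kappa> p f d b D M N f d b"
      and q: "\<And>k. k \<in> I - X \<Longrightarrow> vm p M k = p k" "\<And>k. k \<in> X \<Longrightarrow> ?t (vm p M) k = 0"
      by blast
    define q where "q = vm p M"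
    have cq: "framed_covec f d b D q" using red by (simp add: reduction_def q_def)
    have qi: "?t q i \<noteq> 0" using q(1)[of i] iI it \<open>i \<notin> X\<close> by (simp add: q_def)
    have qk: "b k = b i \<and> f k = - f i" if "k \<in> I" "k \<noteq> i" "?t q k \<noteq> 0" for k
    proof -
      have "k \<notin> X" using q(2)[of k] that by (auto simp: q_def)
      moreover from this have "k \<in> S" using q(1)[of k] that by (simp add: q_def S_def)
      moreover have "f k \<in> {-1, 1}" "f i \<in> {-1, 1}"
        using fr iI that unfolding frame_def by blast+
      ultimately show ?thesis using imin[of k] that(2) unfolding X_def by fastforce
    qed
    show ?thesis
    proof (cases "\<exists>j\<in>I. j \<noteq> i \<and> ?t q j \<noteq> 0")
      case False
      hence "reduction \<kappa> q f d b (D - 2) idm idm f d (b(i := b i + 2))"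
        using raise_weight[OF fr D cq iI qi] by blast
      from reduction_trans[OF red this[unfolded q_def]]
      have "reduction \<kappa> p f d b (D - 2) (mm M idm) (mm idm N) f d (b(i := b i + 2))" by simp
      moreover have "sum (b(i := b i + 2)) I = sum b I + 2"
      proof -
        have "sum (b(i := b i + 2)) I = (\<Sum>k\<in>I. b k + (if k = i then 2 else 0))"
          by (intro sum.cong) auto
        thus ?thesis using finite_I iI by (simp add: sum.distrib)
      qed
      moreover have "\<forall>k\<in>I. 0 \<le> (b(i := b i + 2)) k" using b by force
      ultimately show ?thesis by (metis order_refl)
    next
      case True
      then obtain j where j: "j \<in> I" "j \<noteq> i" "?t q j \<noteq> 0" by blast
      note bfj = qk[OF j]
      define Y where "Y = {k \<in> I - {i, j}. ?t q k \<noteq> 0}"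
      have Y: "b j < b k \<or> b j = b k \<and> f j = f k" if "k \<in> Y" for k
        using qk[of k] that bfj by (auto simp: Y_def)
      have "j \<notin> Y" "Y \<subseteq> I" by (auto simp: Y_def)
      from elimination[OF fr cq j(1) this j(3) D Y] obtain M' N' where
        red': "reduction \<kappa> q f d b D M' N' f d b"
        and r: "\<And>k. k \<in> I - Y \<Longrightarrow> vm q M' k = q k" "\<And>k. k \<in> Y \<Longrightarrow> ?t (vm q M') k = 0"
        by blast
      define r where "r = vm q M'"
      have cr: "framed_covec f d b D r" using red' by (simp add: reduction_def r_def)
      have "?t r i \<noteq> 0" "?t r j \<noteq> 0"
        using r(1)[of i] r(1)[of j] qi j iI by (auto simp: r_def Y_def)
      moreover have "?t r k = 0" if "k \<in> I" "k \<noteq> i" "k \<noteq> j" for k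
        using r[of k] that by (cases "k \<in> Y") (auto simp: r_def Y_def)
      ultimately obtain M'' N'' where red'': "reduction \<kappa> r f d b (D - 2) M'' N'' f
          (d(i := d i + 1, j := d i + 1)) (b(i := b i + 1, j := b i + 1))"
        using mix_opposite_signs[OF fr D cr iI j(1)] j(2) bfj by metis
      let ?b = "b(i := b i + 1, j := b i + 1)"
      have "sum ?b I = sum b I + 2"
      proof -
        have "sum ?b I = (\<Sum>k\<in>I. b k + (if k = i then 1 else 0) + (if k = j then 1 else 0))"
          using bfj j by (intro sum.cong) auto
        thus ?thesis using finite_I iI j by (simp add: sum.distrib)
      qed
      moreover have "\<forall>k\<in>I. 0 \<le> ?b k" using b iI by force
      moreover note reduction_trans[OF red reduction_trans[OF red'[unfolded q_def]
            red''[unfolded r_def q_def]]]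
      ultimately show ?thesis by (metis diff_ge_0_iff_ge le_add_same_cancel1 diff_le_eq zero_le_numeral order_refl)
    qed
  qed
qed

lemma reduction_iterate:
  assumes fr: "frame \<kappa> e c w" and D: "even (D + \<kappa>)" and p: "framed_covec e c w D p"
    and w: "\<And>i. i \<in> I \<Longrightarrow> 0 \<le> w i"
  shows "\<exists>G H f d b. reduction \<kappa> p e c w (D - 2 * int n) G H f d b \<and> (\<forall>i\<in>I. 0 \<le> b i) \<and>
    sum b I \<le> sum w I + 2 * int n"
proof (induction n)
  case 0
  show ?case using reduction_refl[OF fr p] w
    by (intro exI[of _ idm] exI[of _ e] exI[of _ c] exI[of _ w]) auto
next
  case (Suc n)
  then obtain G H f d b where red: "reduction \<kappa> p e c w (D - 2 * int n) G H f d b"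
    and b: "\<forall>i\<in>I. 0 \<le> b i" "sum b I \<le> sum w I + 2 * int n" by blast
  have "even (D - 2 * int n + \<kappa>)" using D by presburger
  with red b obtain M N f' d' b' where
    red': "reduction \<kappa> (vm p G) f d b (D - 2 * int n - 2) M N f' d' b'"
    and b': "\<forall>i\<in>I. 0 \<le> b' i" "sum b' I \<le> sum b I + 2"
    using reduction_step[of \<kappa> f d b "D - 2 * int n" "vm p G"] unfolding reduction_def by metis
  have "reduction \<kappa> p e c w (D - 2 * int (Suc n)) (mm G M) (mm N H) f' d' b'"
    using reduction_trans[OF red red'] by (simp add: algebra_simps)
  moreover have "sum b' I \<le> sum w I + 2 * int (Suc n)" using b(2) b'(2) by simp
  ultimately show ?case using b'(1) by blast
qed

section \<open>Completion of unimodular rows\<close>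

text \<open>In the order basis, the one column that \<open>p\<close> may not annihilate is exchanged
  for \<open>q\<close>; its index \<open>j0\<close> is whatever the reduction leaves. The assumption
  \<open>const\<close> excludes a weight 1 at total length 0, where a unit vector would be too long
  for the coordinate property.\<close>

lemma unimodular_row_completion:
  assumes e: "\<And>l. l \<in> I \<Longrightarrow> e l \<in> {-1, 1}"
    and p: "\<And>l. l \<in> I \<Longrightarrow> p l \<in> homog (e l) (c l) Lp"
    and q: "\<And>l. l \<in> I \<Longrightarrow> q l \<in> homog (e l) (- c l) Lq"
    and L: "0 \<le> Lp" "0 \<le> Lq" and pq: "dot p q = 1"
    and const: "\<And>l. Lp + Lq = 0 \<Longrightarrow> l \<in> I \<Longrightarrow> even (c l)"
  shows "\<exists>j0\<in>I. \<exists>U V f d. inverse_pair U V \<and> f j0 = 1 \<and> d j0 = 0 \<and>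
    (\<forall>i\<in>I. f i \<in> {-1, 1}) \<and> (\<forall>l\<in>I. U j0 l = p l \<and> V l j0 = q l) \<and>
    (\<forall>i\<in>I. \<forall>l\<in>I. U i l \<in> homog (f i * e l) (c l - d i) (Lp + Lq) \<and>
       V l i \<in> homog (e l * f i) (d i - c l) (Lp + Lq))"
proof -
  \<comment> \<open>Weight 1 where \<open>q l\<close> has length at most \<open>Lq - 1\<close> by parity, so \<open>q\<close> has weighted length \<open>Lq\<close>.\<close>
  define w where "w l = (if even (c l + Lq) then 0 else 1 :: int)" for l
  \<comment> \<open>\<open>D0\<close> is at least \<open>Lp\<close>, as \<open>p\<close> requires,
    and has the parity of \<open>Lq\<close>, as the frame requires.\<close>
  define D0 where "D0 = 2 * Lp + Lq"
  \<comment> \<open>A nonzero entry of \<open>vm p G\<close> forces its weight to be at least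
    \<open>2 * n - D0\<close>. Two such entries would give
    \<open>4 * n - 2 * D0 \<le> sum w I + 2 * n\<close>, which this \<open>n\<close>
    excludes.\<close>
  define n where "n = nat (D0 + sum w I + 1)"
  have w01: "0 \<le> w l" "w l \<le> 1" for l by (auto simp: w_def)
  have fr: "frame Lq e c w" using e by (auto simp: frame_def w_def)
  have "framed_covec e c w D0 p"
    unfolding framed_covec_def D0_def using p L w01
    by (auto intro!: homog_mono[OF p] add_nonneg_nonneg simp: add_increasing2)
  moreover have "even (D0 + Lq)" by (simp add: D0_def)
  ultimately obtain G H f d b where
    red: "reduction Lq p e c w (D0 - 2 * int n) G H f d b"
    and b0: "\<And>i. i \<in> I \<Longrightarrow> 0 \<le> b i" and sb: "sum b I \<le> sum w I + 2 * int n"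
    using reduction_iterate[OF fr, of D0 p n] w01 by blast
  define p' where "p' = vm p G"
  define y where "y = mv H q"
  have GH: "inverse_pair G H" using red by (simp add: reduction_def)
  have f: "f i \<in> {-1, 1}" if "i \<in> I" for i
    using red that unfolding reduction_def frame_def by blast
  have sw: "0 \<le> sum w I" by (intro sum_nonneg) (simp add: w01)
  have n: "int n = D0 + sum w I + 1" using sw L by (simp add: n_def D0_def)
  have large: "2 * int n - D0 \<le> b k" if "k \<in> I" "p' k \<noteq> 0" for k
  proof -
    have "p' k \<in> homog (f k) (d k) (D0 - 2 * int n + b k)"
      using red that by (simp add: reduction_def framed_covec_def p'_def)
    thus ?thesis using homog_nonzero_len[OF _ that(2)] by fastforce
  qed
  have uniq: "k = k'" if "k \<in> I" "k' \<in> I" "p' k \<noteq> 0" "p' k' \<noteq> 0" for k k'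
  proof (rule ccontr)
    assume "k \<noteq> k'"
    hence "b k + b k' = sum b {k, k'}" by simp
    also have "\<dots> \<le> sum b I" using that b0 finite_I by (intro sum_mono2) auto
    finally show False using large[of k] large[of k'] that sb n sw by linarith
  qed
  have "I \<noteq> {}" using pq by (auto simp: dot_def)
  then obtain j where j: "j \<in> I" and p'0: "\<And>k. k \<in> I \<Longrightarrow> k \<noteq> j \<Longrightarrow> p' k = 0"
    using uniq by (metis ex_in_conv)
  have dot_p': "dot p' x = p' j * x j" for x
  proof -
    have "dot p' x = (\<Sum>k\<in>{j}. p' k * x k)"
      unfolding dot_def using j p'0 finite_I by (intro sum.mono_neutral_right) auto
    thus ?thesis by simp
  qed
  have "dot p' y = dot p q"
    unfolding p'_def y_def dot_vm by (intro dot_cong) (auto simp: inverse_pair_mv[OF GH])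
  \<comment> \<open>So \<open>y j\<close> is a unit, the row \<open>H j\<close> is \<open>p\<close>
    up to a unit, and \<open>q\<close> can take the place of column \<open>j\<close> of
    \<open>G\<close>.\<close>
  hence unit: "p' j * y j = 1" by (simp add: dot_p' pq)
  have pH: "p l = p' j * H j l" if "l \<in> I" for l
  proof -
    have "p l = dot p (\<lambda>m. idm m l)" using that by (simp add: dot_idm)
    also have "\<dots> = vm p (mm G H) l"
      unfolding vm_def using GH that by (intro dot_cong) (auto simp: inverse_pair_def)
    also have "\<dots> = dot p' (\<lambda>i. H i l)" unfolding vm_mm by (simp add: p'_def vm_def)
    finally show ?thesis by (simp add: dot_p')
  qed
  have Hj: "H j l - y j * p l = 0" if "l \<in> I" for l
  proof -
    have "y j * p l = (p' j * y j) * H j l" using pH[OF that] by (simp add: mult_ac)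
    thus ?thesis by (simp add: unit)
  qed
  have Gy: "dot (G l) y = q l" if "l \<in> I" for l
    using inverse_pair_mv[OF GH that, of q] by (simp add: y_def mv_def)
  \<comment> \<open>As \<open>q\<close> is \<open>G\<close> applied to \<open>y\<close>, this is the
    update of the inverse under exchange of column \<open>j\<close>: row \<open>j\<close> of
    \<open>H\<close> divided by \<open>y j\<close> is \<open>p\<close>, and \<open>y i\<close> times
    it is subtracted from row \<open>i\<close>.\<close>
  define U where "U i l = (if i = j then p l else H i l - y i * p l)" for i l
  define V where "V l i = (if i = j then q l else G l i)" for l i
  have "mm U V i k = idm i k" if "i \<in> I" "k \<in> I" for i k
  proof -
    have "dot (H i) q = y i" by (simp add: y_def mv_def)
    moreover have "dot (H i) (\<lambda>l. G l k) = idm i k"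
      using GH that by (simp add: inverse_pair_def mm_def)
    moreover have "dot p (\<lambda>l. G l k) = p' k" by (simp add: p'_def vm_def)
    moreover have "U i = (if i = j then p else (\<lambda>l. H i l - y i * p l))"
      "(\<lambda>l. V l k) = (if k = j then q else (\<lambda>l. G l k))"
      by (auto simp: U_def V_def)
    ultimately show ?thesis
      using pq p'0[of k] that by (auto simp: mm_def dot_linear idm_def)
  qed
  moreover have "mm V U l m = idm l m" if l: "l \<in> I" and m: "m \<in> I" for l m
  proof -
    \<comment> \<open>For \<open>i = j\<close> the first summand vanishes by \<open>Hj\<close>, so a
      single formula covers all \<open>i\<close>.\<close>
    have "V l i * U i m = G l i * (H i m - y i * p m) + q l * (idm j i * p m)" if "i \<in> I" for i
      using Hj[OF m] by (auto simp: V_def U_def idm_def)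
    hence "mm V U l m = (\<Sum>i\<in>I. G l i * (H i m - y i * p m) + q l * (idm j i * p m))"
      unfolding mm_def dot_def by (intro sum.cong) auto
    also have "\<dots> = dot (G l) (\<lambda>i. H i m - y i * p m) + q l * dot (idm j) (\<lambda>i. p m)"
      by (simp add: dot_def sum.distrib sum_distrib_left)
    also have "\<dots> = mm G H l m - q l * p m + q l * p m"
      using j by (simp add: dot_linear dot_idm Gy[OF l] mm_def)
    finally show ?thesis using GH that by (simp add: inverse_pair_def)
  qed
  ultimately have UV: "inverse_pair U V" by (simp add: inverse_pair_def)
  \<comment> \<open>This bounds the weighted length of column \<open>l\<close> of I - q p; the
    correction by 1 gives it the parity that the coordinate property asks for.\<close>
  define \<delta> where "\<delta> l = Lp + Lq - (if even (Lp + c l) then 0 else 1)" for l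
  have \<delta>: "\<delta> l \<le> Lp + Lq" "even (\<delta> l + c l + Lq)" for l by (auto simp: \<delta>_def)
  \<comment> \<open>The unit vector in that column has weighted length \<open>w l\<close>. With
    total length 0 and odd \<open>c l\<close> one would have \<open>w l = 1\<close> but
    \<open>\<delta> l = -1\<close>.\<close>
  have w\<delta>: "w l \<le> \<delta> l" if "l \<in> I" for l
  proof (cases "Lp + Lq = 0")
    case True
    hence "Lp = 0" "Lq = 0" using L by linarith+
    thus ?thesis using const[OF True that] by (simp add: w_def \<delta>_def)
  next
    case False
    hence "1 \<le> Lp + Lq" using L by simp
    moreover have "2 \<le> Lp + Lq" if "odd (c l + Lq)" "odd (Lp + c l)"
      using that \<open>1 \<le> Lp + Lq\<close> by presburger
    ultimately show ?thesis by (auto simp: w_def \<delta>_def)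
  qed
  have Ul: "H i l - y i * p l \<in> homog (f i * e l) (c l - d i) (\<delta> l - b i)"
    if i: "i \<in> I" and l: "l \<in> I" for i l
  proof -
    let ?x = "\<lambda>m. idm m l - q m * p l"
    have "framed_vec e c w (e l) (c l) (\<delta> l) ?x"
      unfolding framed_vec_def
    proof
      fix m assume m: "m \<in> I"
      have "q m \<in> homog (e m) (- c m) (Lq - w m)"
        using homog_parity[OF q[OF m]] q[OF m] by (auto simp: w_def)
      moreover have "p l \<in> homog (e l) (c l) (\<delta> l - Lq)"
        using homog_parity[OF p[OF l]] p[OF l] by (auto simp: \<delta>_def add.commute)
      ultimately have "q m * p l \<in> homog (e m * e l) (- c m + c l) (Lq - w m + (\<delta> l - Lq))"
        by (rule homog_mult)
      moreover have "framed_vec e c w (e l) (c l) (\<delta> l) (\<lambda>m. idm m l)"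
        using fr l w\<delta>[OF l] by (rule framed_vec_idm)
      ultimately show "idm m l - q m * p l \<in> homog (e m * e l) (c l - c m) (\<delta> l - w m)"
        using m by (auto simp: framed_vec_def intro!: homog_diff)
    qed
    moreover have "dot p ?x \<in> homog (e l) (c l) (D0 - 2 * int n + \<delta> l)"
      using l by (simp add: dot_linear dot_idm pq)
    ultimately have "framed_vec f d b (e l) (c l) (\<delta> l) (mv H ?x)"
      using red e[OF l] \<delta>(2)[of l] unfolding reduction_def by blast
    moreover have "mv H ?x i = H i l - y i * p l"
      using l by (simp add: mv_def dot_linear dot_idm y_def)
    ultimately show ?thesis using i by (auto simp: framed_vec_def)
  qed
  \<comment> \<open>A row of the invertible \<open>U\<close> has a nonzero entry, whose length bound
    \<open>\<delta> l - b i\<close> cannot be negative.\<close>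
  have bi: "b i \<le> Lp + Lq" if "i \<in> I" "i \<noteq> j" for i
  proof -
    have "mm U V i i = 1" using UV that by (simp add: inverse_pair_def idm_def)
    have "\<exists>l\<in>I. U i l \<noteq> 0"
    proof (rule ccontr)
      assume "\<not> ?thesis"
      hence "mm U V i i = 0" by (simp add: mm_def dot_def)
      with \<open>mm U V i i = 1\<close> show False by simp
    qed
    then obtain l where l: "l \<in> I" "U i l \<noteq> 0" by blast
    hence "0 \<le> \<delta> l - b i"
      using homog_nonzero_len[OF Ul[OF that(1) l(1)]] that(2) by (simp add: U_def)
    thus ?thesis using \<delta>(1)[of l] by simp
  qed
  have "U i l \<in> homog ((f(j := 1)) i * e l) (c l - (d(j := 0)) i) (Lp + Lq)"
    if "i \<in> I" "l \<in> I" for i l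
  proof (cases "i = j")
    case True
    thus ?thesis using p[OF that(2)] L by (auto simp: U_def intro: homog_mono)
  next
    case False
    moreover have "\<delta> l - b i \<le> Lp + Lq" using \<delta>(1)[of l] b0[OF that(1)] by simp
    ultimately show ?thesis using Ul[OF that] by (auto simp: U_def intro: homog_mono)
  qed
  moreover have "V l i \<in> homog (e l * (f(j := 1)) i) ((d(j := 0)) i - c l) (Lp + Lq)"
    if "i \<in> I" "l \<in> I" for i l
  proof (cases "i = j")
    case True
    thus ?thesis using q[OF that(2)] L by (auto simp: V_def intro: homog_mono)
  next
    case False
    moreover have "G l i \<in> homog (e l * f i) (d i - c l) (b i - w l)"
      using red that by (simp add: reduction_def framed_vec_def)
    moreover have "b i - w l \<le> Lp + Lq" using bi[OF that(1) False] w01(1)[of l] by simp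
    ultimately show ?thesis by (auto simp: V_def intro: homog_mono)
  qed
  ultimately show ?thesis
    using UV f j
    by (intro bexI[of _ j] exI[of _ U] exI[of _ V] exI[of _ "f(j := 1)"] exI[of _ "d(j := 0)"])
      (auto simp: U_def V_def)
qed

text \<open>Restricting to the joint support \<open>J\<close> of \<open>p\<close> and \<open>q\<close> removes the case \<open>Lp + Lq = 0\<close> with an
  odd \<open>c l\<close>, which \<open>unimodular_row_completion\<close> excludes.\<close>

lemma row_extension:
  assumes e: "\<And>l. l \<in> I \<Longrightarrow> e l \<in> {-1, 1}" and \<phi>: "\<phi> \<in> {-1, 1}"
    and p: "\<And>l. l \<in> I \<Longrightarrow> p l \<in> homog (\<phi> * e l) (c l - \<gamma>) Lp"
    and q: "\<And>l. l \<in> I \<Longrightarrow> q l \<in> homog (e l * \<phi>) (\<gamma> - c l) Lq"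
    and L: "0 \<le> Lp" "0 \<le> Lq" and pq: "dot p q = 1" and i0: "i0 \<in> I"
  shows "\<exists>U V f d. inverse_pair U V \<and> f i0 = \<phi> \<and> d i0 = \<gamma> \<and>
    (\<forall>i\<in>I. f i \<in> {-1, 1}) \<and> (\<forall>l\<in>I. U i0 l = p l \<and> V l i0 = q l) \<and>
    (\<forall>i\<in>I. \<forall>l\<in>I. U i l \<in> homog (f i * e l) (c l - d i) (Lp + Lq) \<and>
       V l i \<in> homog (e l * f i) (d i - c l) (Lp + Lq)) \<and>
    (\<forall>i\<in>I. i \<noteq> i0 \<longrightarrow> p i = 0 \<longrightarrow> q i = 0 \<longrightarrow>
       f i = e i \<and> d i = c i \<and> (\<forall>l\<in>I. U i l = idm i l \<and> V l i = idm l i))"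
proof -
  define J where "J = {l \<in> I. p l \<noteq> 0 \<or> q l \<noteq> 0}"
  have JI: "J \<subseteq> I" by (auto simp: J_def)
  interpret J: framed_matrices K J
    by unfold_locales (use JI finite_I in \<open>auto intro: finite_subset\<close>)
  have dotJ: "dot x y = J.dot x y" if "\<And>l. l \<in> I - J \<Longrightarrow> x l * y l = 0" for x y
    unfolding dot_def J.dot_def using JI finite_I that by (intro sum.mono_neutral_right) auto
  have pqJ: "J.dot p q = 1" using pq by (subst dotJ[symmetric]) (auto simp: J_def)
  \<comment> \<open>On \<open>J\<close> one of \<open>p l\<close>, \<open>q l\<close> is nonzero,
    and at length 0 it is a monomial at its centre, which must then be even.\<close>
  have constJ: "even (c l - \<gamma>)" if "Lp + Lq = 0" "l \<in> J" for l
  proof -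
    have "Lp = 0" "Lq = 0" using that L by linarith+
    hence "p l \<in> homog (\<phi> * e l) (c l - \<gamma>) 0" "q l \<in> homog (e l * \<phi>) (\<gamma> - c l) 0"
      using p q that JI by auto
    hence "even (c l - \<gamma>) \<or> even (\<gamma> - c l)"
      using that(2) homog_zero_len_even unfolding J_def by blast
    thus ?thesis by presburger
  qed
  have eJ: "\<phi> * e l \<in> {-1, 1}" if "l \<in> J" for l
  proof -
    have "e l \<in> {-1, 1}" using e that JI by blast
    thus ?thesis using \<phi> by auto
  qed
  have pJ: "p l \<in> homog (\<phi> * e l) (c l - \<gamma>) Lp" if "l \<in> J" for l
    using p that JI by blast
  have qJ: "q l \<in> homog (\<phi> * e l) (- (c l - \<gamma>)) Lq" if "l \<in> J" for l
    using q[of l] that JI by (auto simp: mult.commute)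
  obtain j0 U V f d where j0: "j0 \<in> J" and UV: "J.inverse_pair U V"
    and fj0: "f j0 = 1" "d j0 = 0" and f: "\<And>i. i \<in> J \<Longrightarrow> f i \<in> {-1, 1}"
    and rows: "\<And>l. l \<in> J \<Longrightarrow> U j0 l = p l" "\<And>l. l \<in> J \<Longrightarrow> V l j0 = q l"
    and types: "\<And>i l. i \<in> J \<Longrightarrow> l \<in> J \<Longrightarrow> U i l \<in> homog (f i * (\<phi> * e l)) (c l - \<gamma> - d i) (Lp + Lq)"
      "\<And>i l. i \<in> J \<Longrightarrow> l \<in> J \<Longrightarrow> V l i \<in> homog (\<phi> * e l * f i) (d i - (c l - \<gamma>)) (Lp + Lq)"
    using J.unimodular_row_completion[of "\<lambda>l. \<phi> * e l" p "\<lambda>l. c l - \<gamma>" Lp q Lq,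
        OF eJ pJ qJ L pqJ constJ] by blast
  \<comment> \<open>The completion puts \<open>p\<close> at an index \<open>j0\<close> of its own
    choice; this transposition moves it to the prescribed \<open>i0\<close>.\<close>
  define \<pi> where "\<pi> i = (if i = i0 then j0 else if i = j0 then i0 else i)" for i
  have \<pi>: "\<pi> (\<pi> i) = i" "i \<in> I \<Longrightarrow> \<pi> i \<in> I" for i
    using i0 j0 JI by (auto simp: \<pi>_def)
  define ext :: "('i \<Rightarrow> 'i \<Rightarrow> laurent) \<Rightarrow> 'i \<Rightarrow> 'i \<Rightarrow> laurent" where
    "ext A i l = (if i \<in> J \<and> l \<in> J then A i l else idm i l)" for A i l
  have mm_ext: "mm (ext A) (ext B) i k = idm i k"
    if AB: "J.inverse_pair A B" and ik: "i \<in> I" "k \<in> I" for A B i k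
  proof (cases "i \<in> J")
    case True
    have "mm (ext A) (ext B) i k = J.dot (ext A i) (\<lambda>l. ext B l k)"
      unfolding mm_def using True by (intro dotJ) (auto simp: ext_def idm_def)
    also have "\<dots> = (if k \<in> J then J.mm A B i k else 0)"
      using True by (auto simp: J.mm_def ext_def idm_def J.dot_def intro!: sum.cong sum.neutral)
    finally show ?thesis using AB True by (auto simp: J.inverse_pair_def idm_def)
  next
    case False
    hence "mm (ext A) (ext B) i k = dot (idm i) (\<lambda>l. ext B l k)"
      unfolding mm_def by (intro dot_cong) (auto simp: ext_def)
    thus ?thesis using False ik by (simp add: dot_idm ext_def)
  qed
  define U' where "U' i l = ext U (\<pi> i) l" for i l
  define V' where "V' l i = ext V l (\<pi> i)" for i l
  \<comment> \<open>On \<open>J\<close> the completion worked with signs \<open>\<phi> * e l\<close>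
    and centres \<open>c l - \<gamma>\<close>; the factor \<open>\<phi>\<close> and the shift by
    \<open>\<gamma>\<close> undo this normalisation.\<close>
  define f' where "f' i = (if \<pi> i \<in> J then \<phi> * f (\<pi> i) else e (\<pi> i))" for i
  define d' where "d' i = (if \<pi> i \<in> J then d (\<pi> i) + \<gamma> else c (\<pi> i))" for i
  have "mm U' V' i k = idm i k" if "i \<in> I" "k \<in> I" for i k
  proof -
    have "mm U' V' i k = mm (ext U) (ext V) (\<pi> i) (\<pi> k)"
      by (simp add: mm_def U'_def[abs_def] V'_def[abs_def])
    also have "\<dots> = idm (\<pi> i) (\<pi> k)" using UV that \<pi> by (intro mm_ext) auto
    also have "\<dots> = idm i k" using \<pi>(1) by (metis idm_def)
    finally show ?thesis .
  qed
  moreover have "mm V' U' l m = idm l m" if "l \<in> I" "m \<in> I" for l m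
  proof -
    have "mm V' U' l m = mm (ext V) (ext U) l m"
      unfolding mm_def dot_def U'_def V'_def
      by (rule sum.reindex_bij_witness[of _ \<pi> \<pi>]) (auto simp: \<pi>)
    thus ?thesis using mm_ext[OF J.inverse_pair_sym[OF UV] that] by simp
  qed
  ultimately have "inverse_pair U' V'" by (simp add: inverse_pair_def)
  moreover have "f' i0 = \<phi>" "d' i0 = \<gamma>"
    using j0 fj0 by (simp_all add: f'_def d'_def \<pi>_def)
  moreover have "f' i \<in> {-1, 1}" if "i \<in> I" for i
    using f[of "\<pi> i"] e[of "\<pi> i"] \<phi> \<pi>(2)[OF that] by (auto simp: f'_def)
  moreover have "U' i0 l = p l" "V' l i0 = q l" if "l \<in> I" for l
  proof -
    have "l \<notin> J \<Longrightarrow> p l = 0 \<and> q l = 0" using that by (auto simp: J_def)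
    thus "U' i0 l = p l" "V' l i0 = q l"
      using j0 rows by (auto simp: U'_def V'_def ext_def \<pi>_def idm_def)
  qed
  moreover have "U' i l \<in> homog (f' i * e l) (c l - d' i) (Lp + Lq)"
    "V' l i \<in> homog (e l * f' i) (d' i - c l) (Lp + Lq)" if i: "i \<in> I" and l: "l \<in> I" for i l
  proof -
    have ee: "e l * e l = 1" using e[OF l] by auto
    have "1 \<in> homog 1 0 (Lp + Lq)" using L by (intro homog_1) simp
    thus "U' i l \<in> homog (f' i * e l) (c l - d' i) (Lp + Lq)"
      "V' l i \<in> homog (e l * f' i) (d' i - c l) (Lp + Lq)"
      using types[of "\<pi> i" l] ee
      by (auto simp: U'_def V'_def ext_def f'_def d'_def idm_def algebra_simps)
  qed
  \<comment> \<open>Indices outside \<open>J\<close> other than \<open>i0\<close> are fixed by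
    \<open>\<pi>\<close> and carry unit rows. This is what preserves the rows already completed when
    another one is added.\<close>
  moreover have "f' i = e i \<and> d' i = c i \<and> (\<forall>l\<in>I. U' i l = idm i l \<and> V' l i = idm l i)"
    if "i \<in> I" "i \<noteq> i0" "p i = 0" "q i = 0" for i
  proof -
    have "i \<notin> J" using that by (simp add: J_def)
    moreover from this have "\<pi> i = i" using j0 that by (auto simp: \<pi>_def)
    ultimately show ?thesis by (simp add: f'_def d'_def U'_def V'_def ext_def)
  qed
  ultimately show ?thesis by (intro exI[of _ U'] exI[of _ V'] exI[of _ f'] exI[of _ d']) blast
qed

lemma homog_mm:
  assumes "\<And>j. j \<in> I \<Longrightarrow> f j \<in> {-1, 1}"
    and "\<And>j. j \<in> I \<Longrightarrow> A i j \<in> homog (a * f j) (d j - b) L"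
    and "\<And>j. j \<in> I \<Longrightarrow> B j k \<in> homog (f j * a') (b' - d j) L'"
  shows "mm A B i k \<in> homog (a * a') (b' - b) (L + L')"
  unfolding mm_def dot_def
proof (rule homog_sum)
  fix j assume j: "j \<in> I"
  have "A i j * B j k \<in> homog (a * f j * (f j * a')) (d j - b + (b' - d j)) (L + L')"
    using assms(2,3)[OF j] by (rule homog_mult)
  thus "A i j * B j k \<in> homog (a * a') (b' - b) (L + L')"
    using assms(1)[OF j] by (simp only: sign_cancel) (simp add: algebra_simps)
qed

end

section \<open>Adding the rows one at a time\<close>

context coefficient_field
begin

text \<open>Each new row is completed in the coordinates of the current pair, whose types
  \<open>f\<close>, \<open>d\<close> replace \<open>e\<close>, \<open>c\<close>. The bound grows
  from \<open>L'\<close> to \<open>2 * L + 3 * L'\<close> per row, hence only its existence is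
  asserted.\<close>

lemma multirow_extension:
  fixes P Q :: "nat \<Rightarrow> nat \<Rightarrow> laurent"
  assumes fin: "I = {..<s}" and e: "\<And>l. l < s \<Longrightarrow> e l \<in> {-1, 1}" and L: "0 \<le> L" and "r \<le> s"
    and "\<And>i. i < r \<Longrightarrow> \<phi> i \<in> {-1, 1}"
    and "\<And>i l. i < r \<Longrightarrow> l < s \<Longrightarrow> P i l \<in> homog (\<phi> i * e l) (c l - \<gamma> i) L"
    and "\<And>i l. i < r \<Longrightarrow> l < s \<Longrightarrow> Q l i \<in> homog (e l * \<phi> i) (\<gamma> i - c l) L"
    and "\<And>i k. i < r \<Longrightarrow> k < r \<Longrightarrow> (\<Sum>l\<in>I. P i l * Q l k) = (if i = k then 1 else 0)"
  shows "\<exists>U V f d L'. framed_matrices.inverse_pair I U V \<and> 0 \<le> L' \<and> (\<forall>i<s. f i \<in> {-1, 1}) \<and>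
    (\<forall>i<r. f i = \<phi> i \<and> d i = \<gamma> i \<and> (\<forall>l<s. U i l = P i l \<and> V l i = Q l i)) \<and>
    (\<forall>i<s. \<forall>l<s. U i l \<in> homog (f i * e l) (c l - d i) L' \<and> V l i \<in> homog (e l * f i) (d i - c l) L')"
  using assms(4-)
proof (induction r)
  interpret framed_matrices K I by unfold_locales (simp add: fin)
  case 0
  have "idm i l \<in> homog (e i * e l) (c l - c i) 0" "idm l i \<in> homog (e l * e i) (c i - c l) 0"
    if "i < s" for i l
    using e[OF that] by (auto simp: idm_def intro: homog_1)
  thus ?case using e inverse_pair_idm
    by (intro exI[of _ idm] exI[of _ e] exI[of _ c] exI[of _ 0]) auto
next
  interpret framed_matrices K I by unfold_locales (simp add: fin)
  case (Suc r)
  have PQ: "dot (P i) (\<lambda>l. Q l k) = (if i = k then 1 else 0)" if "i < Suc r" "k < Suc r" for i k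
    using Suc.prems(5)[OF that] by (simp add: dot_def)
  have "\<exists>U V f d L'. inverse_pair U V \<and> 0 \<le> L' \<and> (\<forall>i<s. f i \<in> {-1, 1}) \<and>
      (\<forall>i<r. f i = \<phi> i \<and> d i = \<gamma> i \<and> (\<forall>l<s. U i l = P i l \<and> V l i = Q l i)) \<and>
      (\<forall>i<s. \<forall>l<s. U i l \<in> homog (f i * e l) (c l - d i) L' \<and> V l i \<in> homog (e l * f i) (d i - c l) L')"
  proof (rule Suc.IH)
    show "r \<le> s" using Suc.prems(1) by simp
    fix i assume i: "i < r"
    show "\<phi> i \<in> {-1, 1}" using Suc.prems(2)[of i] i by simp
    fix l assume l: "l < s"
    show "P i l \<in> homog (\<phi> i * e l) (c l - \<gamma> i) L" using Suc.prems(3)[of i l] i l by simp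
    show "Q l i \<in> homog (e l * \<phi> i) (\<gamma> i - c l) L" using Suc.prems(4)[of i l] i l by simp
  next
    fix i k assume "i < r" "k < r"
    thus "(\<Sum>l\<in>I. P i l * Q l k) = (if i = k then 1 else 0)" using Suc.prems(5)[of i k] by simp
  qed
  then obtain U V f d L' where UV: "inverse_pair U V" and L': "0 \<le> L'"
    and f: "\<And>i. i < s \<Longrightarrow> f i \<in> {-1, 1}"
    and rows: "\<And>i. i < r \<Longrightarrow> f i = \<phi> i \<and> d i = \<gamma> i" "\<And>i l. i < r \<Longrightarrow> l < s \<Longrightarrow> U i l = P i l \<and> V l i = Q l i"
    and types: "\<And>i l. i < s \<Longrightarrow> l < s \<Longrightarrow> U i l \<in> homog (f i * e l) (c l - d i) L'"
      "\<And>i l. i < s \<Longrightarrow> l < s \<Longrightarrow> V l i \<in> homog (e l * f i) (d i - c l) L'"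
    by blast
  define p where "p = vm (P r) V"
  define q where "q = mv U (\<lambda>l. Q l r)"
  have r: "r < s" "r \<in> I" using Suc.prems(1) by (auto simp: fin)
  have \<phi>r: "\<phi> r \<in> {-1, 1}" using Suc.prems(2) by blast
  have tp: "p l \<in> homog (\<phi> r * f l) (d l - \<gamma> r) (L + L')" if "l \<in> I" for l
  proof -
    have "mm P V r l \<in> homog (\<phi> r * f l) (d l - \<gamma> r) (L + L')"
      using that r e Suc.prems(3) types(2) by (intro homog_mm[where f = e and d = c]) (auto simp: fin)
    thus ?thesis by (simp add: p_def vm_def mm_def)
  qed
  have tq: "q l \<in> homog (f l * \<phi> r) (\<gamma> r - d l) (L' + L)" if "l \<in> I" for l
  proof -
    have "mm U Q l r \<in> homog (f l * \<phi> r) (\<gamma> r - d l) (L' + L)"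
      using that r e Suc.prems(4) types(1) by (intro homog_mm[where f = e and d = c]) (auto simp: fin)
    thus ?thesis by (simp add: q_def mv_def mm_def)
  qed
  have VUq: "mv V q l = Q l r" if "l \<in> I" for l
    using inverse_pair_mv[OF inverse_pair_sym[OF UV] that] by (simp add: q_def)
  have "dot p q = dot (P r) (\<lambda>l. Q l r)"
    unfolding p_def dot_vm using VUq by (intro dot_cong) auto
  hence pq: "dot p q = 1" using PQ by simp
  have p0: "p i = 0" and q0: "q i = 0" if "i < r" for i
  proof -
    have "p i = dot (P r) (\<lambda>l. Q l i)"
      unfolding p_def vm_def using rows that by (intro dot_cong) (auto simp: fin)
    thus "p i = 0" using PQ that by simp
    have "q i = dot (P i) (\<lambda>l. Q l r)"
      unfolding q_def mv_def using rows that by (intro dot_cong) (auto simp: fin)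
    thus "q i = 0" using PQ that by simp
  qed
  define M where "M = L + L' + (L' + L)"
  have f': "\<And>l. l \<in> I \<Longrightarrow> f l \<in> {-1, 1}" using f by (auto simp: fin)
  have LL: "0 \<le> L + L'" "0 \<le> L' + L" using L L' by auto
  obtain U' V' f' d' where UV': "inverse_pair U' V'" and r': "f' r = \<phi> r" "d' r = \<gamma> r"
    and f'_sign: "\<And>i. i \<in> I \<Longrightarrow> f' i \<in> {-1, 1}"
    and row': "\<And>l. l \<in> I \<Longrightarrow> U' r l = p l" "\<And>l. l \<in> I \<Longrightarrow> V' l r = q l"
    and types': "\<And>i l. i \<in> I \<Longrightarrow> l \<in> I \<Longrightarrow> U' i l \<in> homog (f' i * f l) (d l - d' i) M"
      "\<And>i l. i \<in> I \<Longrightarrow> l \<in> I \<Longrightarrow> V' l i \<in> homog (f l * f' i) (d' i - d l) M"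
    and old: "\<And>i. i \<in> I \<Longrightarrow> i \<noteq> r \<Longrightarrow> p i = 0 \<Longrightarrow> q i = 0 \<Longrightarrow>
       f' i = f i \<and> d' i = d i \<and> (\<forall>l\<in>I. U' i l = idm i l \<and> V' l i = idm l i)"
    using row_extension[OF f' \<phi>r tp tq LL pq r(2), folded M_def] by blast
  have "inverse_pair (mm U' U) (mm V V')"
    using UV' UV by (rule inverse_pair_mm)
  moreover have "0 \<le> M + L'" using L L' by (simp add: M_def)
  moreover have "f' i = \<phi> i \<and> d' i = \<gamma> i \<and> (\<forall>l<s. mm U' U i l = P i l \<and> mm V V' l i = Q l i)"
    if "i < Suc r" for i
  proof (cases "i = r")
    case True
    have "mm U' U r l = P r l \<and> mm V V' l r = Q l r" if l: "l \<in> I" for l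
    proof
      have "mm U' U r l = vm p U l"
        unfolding mm_def vm_def using row' by (intro dot_cong) auto
      also have "\<dots> = vm (P r) (mm V U) l" unfolding p_def vm_mm ..
      also have "\<dots> = dot (P r) (\<lambda>m. idm m l)"
        unfolding vm_def using UV l by (intro dot_cong) (auto simp: inverse_pair_def)
      finally show "mm U' U r l = P r l" using l by (simp add: dot_idm)
      have "mm V V' l r = mv V q l"
        unfolding mm_def mv_def using row' by (intro dot_cong) auto
      thus "mm V V' l r = Q l r" using VUq l by simp
    qed
    thus ?thesis using True r' by (simp add: fin)
  next
    case False
    hence ir: "i < r" and iI: "i \<in> I" using that r by (auto simp: fin)
    \<comment> \<open>Row \<open>i\<close> of \<open>U'\<close> and column \<open>i\<close> of
      \<open>V'\<close> are unit vectors, so the products return the earlier row and column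
      unchanged.\<close>
    note o = old[OF iI False p0[OF ir] q0[OF ir]]
    have "mm U' U i l = P i l \<and> mm V V' l i = Q l i" if l: "l \<in> I" for l
    proof
      have ls: "l < s" using l by (simp add: fin)
      have "mm U' U i l = mm idm U i l" using o by (intro mm_cong) auto
      thus "mm U' U i l = P i l" using rows(2)[OF ir] l by (simp add: mm_idm(1)[OF iI] ls)
      have "mm V V' l i = mm V idm l i" using o by (intro mm_cong) auto
      thus "mm V V' l i = Q l i" using rows(2)[OF ir] l by (simp add: mm_idm(2)[OF iI] ls)
    qed
    thus ?thesis using o rows(1)[OF ir] by (simp add: fin)
  qed
  moreover have "mm U' U i l \<in> homog (f' i * e l) (c l - d' i) (M + L')"
    "mm V V' l i \<in> homog (e l * f' i) (d' i - c l) (M + L')" if "i < s" "l < s" for i l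
  proof -
    show "mm U' U i l \<in> homog (f' i * e l) (c l - d' i) (M + L')"
      using that f' types' types by (intro homog_mm[where f = f and d = d]) (auto simp: fin)
    have "mm V V' l i \<in> homog (e l * f' i) (d' i - c l) (L' + M)"
      using that f' types' types by (intro homog_mm[where f = f and d = d]) (auto simp: fin)
    thus "mm V V' l i \<in> homog (e l * f' i) (d' i - c l) (M + L')" by (simp add: add.commute)
  qed
  ultimately show ?case
    using f'_sign
    by (intro exI[of _ "mm U' U"] exI[of _ "mm V V'"] exI[of _ f'] exI[of _ d'] exI[of _ "M + L'"])
      (auto simp: fin)
qed

end

section \<open>Symmetry types read off from the given rows, and the matrix statement\<close>

lemma Sop_mat_row_monom:
  assumes "\<theta> \<in> lmats F 1 n" "T \<in> Sop_mat \<theta>"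
  obtains e c where "\<And>l. l < n \<Longrightarrow> e l \<in> {-1, 1}" "\<And>l. l < n \<Longrightarrow> T $$ (0, l) = lmonom (c l) (e l)"
    "T \<in> carrier_mat 1 n"
proof -
  have "\<exists>e c. e \<in> {-1, 1} \<and> T $$ (0, l) = lmonom c e" if "l < n" for l
  proof -
    have "T $$ (0, l) \<in> Sop (\<theta> $$ (0, l))"
      using assms that by (auto simp: lmats_def Sop_mat_def)
    thus ?thesis unfolding Sop_def by blast
  qed
  then obtain e c where "\<And>l. l < n \<Longrightarrow> e l \<in> {-1, 1} \<and> T $$ (0, l) = lmonom (c l) (e l)"
    by metis
  moreover have "T \<in> carrier_mat 1 n"
    using assms by (auto simp: lmats_def Sop_mat_def)
  ultimately show ?thesis using that by blast
qed

lemma star_mult_entry: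
  assumes "T \<in> carrier_mat 1 r" "T' \<in> carrier_mat 1 s" "i < r" "l < s"
    and "T $$ (0, i) = lmonom \<gamma> \<phi>" "T' $$ (0, l) = lmonom c e" "\<phi> \<in> {-1, 1}"
  shows "(lmat_star T * T') $$ (i, l) = lmonom (c - \<gamma>) (\<phi> * e)"
proof -
  have "cnj \<phi> = \<phi>" using assms(7) by auto
  thus ?thesis
    using assms by (simp add: lmat_star_def scalar_prod_def lp_star_monom mult_single)
qed

theorem theorem1:
  fixes F :: "complex set" and r s :: nat
    and P Pt \<theta>\<^sub>1 \<theta>\<^sub>2 T\<^sub>1 T\<^sub>2 :: lmat
  assumes "complex_subfield F"
    and "1 \<le> r" and "r \<le> s"
    and "P \<in> lmats F r s" and "Pt \<in> lmats F r s"
    and "lmat_over F (lmat_star P)" and "lmat_over F (lmat_star Pt)"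
    and "mat_has_symmetry P" and "mat_has_symmetry Pt"
    and "\<theta>\<^sub>1 \<in> lmats F 1 r" and "mat_has_symmetry \<theta>\<^sub>1"
    and "\<theta>\<^sub>2 \<in> lmats F 1 s" and "mat_has_symmetry \<theta>\<^sub>2"
    and "T\<^sub>1 \<in> Sop_mat \<theta>\<^sub>1" and "T\<^sub>2 \<in> Sop_mat \<theta>\<^sub>2"
    and "lmat_star T\<^sub>1 * T\<^sub>2 \<in> Sop_mat P" and "lmat_star T\<^sub>1 * T\<^sub>2 \<in> Sop_mat Pt"
    and "biorthogonal P Pt"
  shows "\<exists>Pe \<in> lmats F s s. \<exists>Pte \<in> lmats F s s.
      mat r s (\<lambda>(i, j). if i = j then 1 else 0) * Pe = P \<and>
      mat r s (\<lambda>(i, j). if i = j then 1 else 0) * Pte = Pt \<and>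
      biorthogonal Pe Pte \<and>
      mat_has_symmetry Pe \<and> mat_has_symmetry Pte \<and>
      (\<exists>\<theta> \<in> lmats F 1 s. mat_has_symmetry \<theta> \<and>
         (\<exists>T \<in> Sop_mat \<theta>. lmat_star T * T\<^sub>2 \<in> Sop_mat Pe \<and> lmat_star T * T\<^sub>2 \<in> Sop_mat Pte)) \<and>
      (\<exists>J \<ge> 1. \<exists>A At :: nat \<Rightarrow> lmat.
         Pe = desc_prod s A J \<and> Pte = desc_prod s At J \<and>
         (\<forall>j \<in> {1..J}. A j \<in> lmats F s s \<and> At j \<in> lmats F s s \<and>
            mat_has_symmetry (A j) \<and> mat_has_symmetry (At j) \<and> biorthogonal (A j) (At j)) \<and>
         (\<forall>j \<in> {1..<J}. mutually_compatible F (A (Suc j)) (A j) \<and>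
            mutually_compatible F (At (Suc j)) (At j))) \<and>
      (r = 1 \<longrightarrow>
         max (max_csupp_len Pe) (max_csupp_len Pte) \<le> max_csupp_len P + max_csupp_len Pt)"
proof -
  \<comment> \<open>The largest subfield of \<open>F\<close> closed under conjugation. The
    hypotheses on \<open>lmat_star P\<close> and \<open>lmat_star Pt\<close> place all coefficients
    in it, and the construction needs only field operations, so \<open>V\<close> can be conjugated
    without leaving \<open>F\<close>.\<close>
  define K where "K = {x \<in> F. cnj x \<in> F}"
  interpret coefficient_field K
    using assms(1) by unfold_locales (auto simp: complex_subfield_def K_def)
  have cnjK: "cnj x \<in> K" if "x \<in> K" for x using that by (simp add: K_def)
  have P: "P \<in> carrier_mat r s" and Pt: "Pt \<in> carrier_mat r s"
    using assms(4,5) by (auto simp: lmats_def)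
  have coeffs: "lcoeff (A $$ (i, l)) k \<in> K"
    if "A \<in> lmats F r s" "lmat_over F (lmat_star A)" "i < r" "l < s" for A i l k
  proof -
    have "lcoeff (lp_star (A $$ (i, l))) (- k) \<in> F"
      using that by (auto simp: lmats_def lmat_over_def lmat_star_def)
    thus ?thesis using that by (auto simp: K_def lmats_def lmat_over_def lcoeff_lp_star)
  qed
  obtain \<phi> \<gamma> where \<phi>: "\<And>i. i < r \<Longrightarrow> \<phi> i \<in> {-1, 1}"
    and T1: "\<And>i. i < r \<Longrightarrow> T\<^sub>1 $$ (0, i) = lmonom (\<gamma> i) (\<phi> i)" "T\<^sub>1 \<in> carrier_mat 1 r"
    using Sop_mat_row_monom[OF assms(10,14)] by metis
  obtain e c where e: "\<And>l. l < s \<Longrightarrow> e l \<in> {-1, 1}"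
    and T2: "\<And>l. l < s \<Longrightarrow> T\<^sub>2 $$ (0, l) = lmonom (c l) (e l)" "T\<^sub>2 \<in> carrier_mat 1 s"
    using Sop_mat_row_monom[OF assms(12,15)] by metis
  have \<phi>e: "\<phi> i * e l \<in> {-1, 1}" if "i < r" "l < s" for i l
    using \<phi>[OF that(1)] e[OF that(2)] by auto
  have types: "A $$ (i, l) \<in> homog (\<phi> i * e l) (c l - \<gamma> i) L"
    if A: "A \<in> lmats F r s" "lmat_over F (lmat_star A)" "lmat_star T\<^sub>1 * T\<^sub>2 \<in> Sop_mat A"
      and il: "i < r" "l < s" and L: "csupp_len (A $$ (i, l)) \<le> ereal (of_int L)" for A i l L
  proof -
    have "(lmat_star T\<^sub>1 * T\<^sub>2) $$ (i, l) \<in> Sop (A $$ (i, l))"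
      using A(1,3) il by (auto simp: lmats_def Sop_mat_def)
    hence "lmonom (c l - \<gamma> i) (\<phi> i * e l) \<in> Sop (A $$ (i, l))"
      by (simp only: star_mult_entry[OF T1(2) T2(2) il T1(1)[OF il(1)] T2(1)[OF il(2)] \<phi>[OF il(1)]])
    thus ?thesis
      using lmonom_in_Sop_iff[OF \<phi>e[OF il]] coeffs[OF A(1,2) il] L by (intro homogI) auto
  qed
  have bi: "(\<Sum>l<s. P $$ (i, l) * lp_star (Pt $$ (k, l))) = (if i = k then 1 else 0)"
    if "i < r" "k < r" for i k
    using assms(18) that unfolding biorthogonal_iff[OF P Pt] by blast
  \<comment> \<open>A sum equal to 1 has a nonzero term, so \<open>P\<close> and \<open>Pt\<close>
    both have a nonzero entry and their maximal lengths are integers.\<close>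
  have "(\<Sum>l<s. P $$ (0, l) * lp_star (Pt $$ (0, l))) = 1"
    using bi[of 0 0] assms(2) by simp
  hence "\<not> (\<forall>l\<in>{..<s}. P $$ (0, l) * lp_star (Pt $$ (0, l)) = 0)"
    using sum.neutral zero_neq_one by fastforce
  then obtain l0 where l0: "l0 < s" "P $$ (0, l0) \<noteq> 0" "lp_star (Pt $$ (0, l0)) \<noteq> 0" by auto
  moreover have "lp_star 0 = 0" by (simp add: lp_star_def)
  ultimately have "Pt $$ (0, l0) \<noteq> 0" by auto
  have r0: "0 < r" using assms(2) by simp
  obtain Lp where Lp: "0 \<le> Lp" "max_csupp_len P = ereal (of_int Lp)"
    "\<And>i l. i < r \<Longrightarrow> l < s \<Longrightarrow> csupp_len (P $$ (i, l)) \<le> ereal (of_int Lp)"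
    using max_csupp_len_integer[OF P r0 l0(1,2)] by blast
  obtain Lq where Lq: "0 \<le> Lq" "max_csupp_len Pt = ereal (of_int Lq)"
    "\<And>i l. i < r \<Longrightarrow> l < s \<Longrightarrow> csupp_len (Pt $$ (i, l)) \<le> ereal (of_int Lq)"
    using max_csupp_len_integer[OF Pt r0 l0(1) \<open>Pt $$ (0, l0) \<noteq> 0\<close>] by blast
  have tP: "P $$ (i, l) \<in> homog (\<phi> i * e l) (c l - \<gamma> i) Lp" if "i < r" "l < s" for i l
    using types[OF assms(4,6,16) that Lp(3)[OF that]] .
  have tQ: "lp_star (Pt $$ (i, l)) \<in> homog (e l * \<phi> i) (\<gamma> i - c l) Lq" if "i < r" "l < s" for i l
    using homog_lp_star[OF types[OF assms(5,7,17) that Lq(3)[OF that]] \<phi>e[OF that] cnjK]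
    by (simp add: mult.commute)
  define I where "I = {..<s}"
  interpret framed_matrices K I by unfold_locales (simp add: I_def)
  obtain U V f d L where UV: "inverse_pair U V" and f: "\<And>i. i < s \<Longrightarrow> f i \<in> {-1, 1}"
    and rows: "\<And>i l. i < r \<Longrightarrow> l < s \<Longrightarrow> U i l = P $$ (i, l) \<and> V l i = lp_star (Pt $$ (i, l))"
    and tU: "\<And>i l. i < s \<Longrightarrow> l < s \<Longrightarrow> U i l \<in> homog (f i * e l) (c l - d i) L"
    and tV: "\<And>i l. i < s \<Longrightarrow> l < s \<Longrightarrow> V l i \<in> homog (e l * f i) (d i - c l) L"
    and L: "r = 1 \<Longrightarrow> L = Lp + Lq"
  proof (cases "r = 1")
    \<comment> \<open>The direct use of \<open>row_extension\<close> keeps \<open>Lp\<close> and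
      \<open>Lq\<close> apart and gives the bound in (v); the induction over rows would start from a
      common bound for both and lose it.\<close>
    case True
    have pq: "dot (\<lambda>l. P $$ (0, l)) (\<lambda>l. lp_star (Pt $$ (0, l))) = 1"
      using bi[OF r0 r0] unfolding dot_def by (simp add: I_def)
    have "\<And>l. l \<in> I \<Longrightarrow> e l \<in> {-1, 1}" "\<phi> 0 \<in> {-1, 1}"
      "\<And>l. l \<in> I \<Longrightarrow> P $$ (0, l) \<in> homog (\<phi> 0 * e l) (c l - \<gamma> 0) Lp"
      "\<And>l. l \<in> I \<Longrightarrow> lp_star (Pt $$ (0, l)) \<in> homog (e l * \<phi> 0) (\<gamma> 0 - c l) Lq" "0 \<in> I"
      using e \<phi>[OF r0] tP[OF r0] tQ[OF r0] l0(1) by (auto simp: I_def)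
    from row_extension[OF this(1-4) Lp(1) Lq(1) pq this(5)] obtain U V f d where
      "inverse_pair U V" "\<forall>i\<in>I. f i \<in> {-1, 1}"
      "\<forall>l\<in>I. U 0 l = P $$ (0, l) \<and> V l 0 = lp_star (Pt $$ (0, l))"
      "\<forall>i\<in>I. \<forall>l\<in>I. U i l \<in> homog (f i * e l) (c l - d i) (Lp + Lq) \<and>
         V l i \<in> homog (e l * f i) (d i - c l) (Lp + Lq)"
      by blast
    thus ?thesis using True by (intro that[of U V f d "Lp + Lq"]) (auto simp: I_def)
  next
    case False
    have "P $$ (i, l) \<in> homog (\<phi> i * e l) (c l - \<gamma> i) (Lp + Lq)"
      "lp_star (Pt $$ (i, l)) \<in> homog (e l * \<phi> i) (\<gamma> i - c l) (Lp + Lq)" if "i < r" "l < s" for i l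
      using tP[OF that] tQ[OF that] Lp(1) Lq(1) by (auto intro: homog_mono)
    moreover have "0 \<le> Lp + Lq" using Lp(1) Lq(1) by simp
    moreover have "(\<Sum>l\<in>I. P $$ (i, l) * lp_star (Pt $$ (k, l))) = (if i = k then 1 else 0)"
      if "i < r" "k < r" for i k using bi[OF that] by (simp add: I_def)
    ultimately have "\<exists>U V f d L'. inverse_pair U V \<and> 0 \<le> L' \<and> (\<forall>i<s. f i \<in> {-1, 1}) \<and>
      (\<forall>i<r. f i = \<phi> i \<and> d i = \<gamma> i \<and> (\<forall>l<s. U i l = P $$ (i, l) \<and> V l i = lp_star (Pt $$ (i, l)))) \<and>
      (\<forall>i<s. \<forall>l<s. U i l \<in> homog (f i * e l) (c l - d i) L' \<and> V l i \<in> homog (e l * f i) (d i - c l) L')"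
      using e \<phi> assms(3)
      by (intro multirow_extension[where P = "\<lambda>i l. P $$ (i, l)" and Q = "\<lambda>l i. lp_star (Pt $$ (i, l))"
            and L = "Lp + Lq"]) (simp_all add: I_def)
    then obtain U V f d L' where "inverse_pair U V" "\<forall>i<s. f i \<in> {-1, 1}"
      "\<forall>i<r. f i = \<phi> i \<and> d i = \<gamma> i \<and> (\<forall>l<s. U i l = P $$ (i, l) \<and> V l i = lp_star (Pt $$ (i, l)))"
      "\<forall>i<s. \<forall>l<s. U i l \<in> homog (f i * e l) (c l - d i) L' \<and> V l i \<in> homog (e l * f i) (d i - c l) L'"
      by blast
    thus ?thesis using False by (intro that[of U V f d L']) auto
  qed
  define Pe where "Pe = mat s s (\<lambda>(i, l). U i l)"
  define Pte where "Pte = mat s s (\<lambda>(i, l). lp_star (V l i))"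
  have fe: "f i * e l \<in> {-1, 1}" if "i < s" "l < s" for i l
    using f[OF that(1)] e[OF that(2)] by auto
  have tV': "lp_star (V l i) \<in> homog (f i * e l) (c l - d i) L" if "i < s" "l < s" for i l
    using homog_lp_star[OF tV[OF that] _ cnjK] fe[OF that] by (simp add: mult.commute)
  have KF: "f \<in> homog a b L \<Longrightarrow> lcoeff f k \<in> F" for f a b k
  proof -
    assume "f \<in> homog a b L"
    hence "lcoeff f k \<in> K" unfolding homog_def by blast
    thus "lcoeff f k \<in> F" by (simp add: K_def)
  qed
  have mem: "Pe \<in> lmats F s s" "Pte \<in> lmats F s s"
    using KF[OF tU] KF[OF tV'] by (simp_all add: lmats_def Pe_def Pte_def lmat_over_def)
  have top: "mat r s (\<lambda>(i, j). if i = j then 1 else 0) * A = B"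
    if "A \<in> carrier_mat s s" "B \<in> carrier_mat r s" "\<And>i l. i < r \<Longrightarrow> l < s \<Longrightarrow> A $$ (i, l) = B $$ (i, l)"
    for A B :: lmat
  proof (rule eq_matI)
    fix i l assume il: "i < dim_row B" "l < dim_col B"
    have "(mat r s (\<lambda>(i, j). if i = j then 1 else 0) * A) $$ (i, l) =
        (\<Sum>k = 0..<s. (if i = k then 1 else 0) * A $$ (k, l))"
      using that(1,2) il by (simp add: scalar_prod_def)
    also have "\<dots> = (\<Sum>k = 0..<s. if i = k then A $$ (k, l) else 0)"
      by (intro sum.cong) auto
    also have "\<dots> = B $$ (i, l)" using that il assms(3) by auto
    finally show "(mat r s (\<lambda>(i, j). if i = j then 1 else 0) * A) $$ (i, l) = B $$ (i, l)" .
  qed (use that in auto)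
  have ext: "mat r s (\<lambda>(i, j). if i = j then 1 else 0) * Pe = P"
    "mat r s (\<lambda>(i, j). if i = j then 1 else 0) * Pte = Pt"
    using P Pt rows assms(3) by (auto intro!: top simp: Pe_def Pte_def)
  have bio: "biorthogonal Pe Pte"
  proof -
    have "(\<Sum>l<s. U i l * V l k) = (if i = k then 1 else 0)" if "i < s" "k < s" for i k
    proof -
      have "i \<in> I" "k \<in> I" using that by (simp_all add: I_def)
      hence "mm U V i k = idm i k" using UV by (simp add: inverse_pair_def)
      thus ?thesis unfolding mm_def dot_def idm_def by (simp add: I_def)
    qed
    thus ?thesis
      by (subst biorthogonal_iff[of _ s s]) (auto simp: Pe_def Pte_def)
  qed
  \<comment> \<open>The row \<open>\<theta>\<close> is zero, so that \<open>S \<theta>\<close> can be any row of monomials \<open>\<plusminus>z^d\<close>.\<close>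
  define T where "T = mat 1 s (\<lambda>(_, i). lmonom (d i) (f i))"
  have "lmonom (d i) (f i) \<in> Sop 0" if "i < s" for i
    using f[OF that] by (simp add: lmonom_in_Sop_iff)
  hence T: "T \<in> Sop_mat (0\<^sub>m 1 s)" by (auto simp: Sop_mat_def T_def)
  have T_entry: "(lmat_star T * T\<^sub>2) $$ (i, l) = lmonom (c l - d i) (f i * e l)" if "i < s" "l < s" for i l
    using that f[OF that(1)] T2 by (intro star_mult_entry[of _ s _ s]) (auto simp: T_def)
  have "lmat_star T * T\<^sub>2 \<in> carrier_mat s s"
    using T2(2) by (auto simp: lmat_star_def T_def)
  hence Sop: "lmat_star T * T\<^sub>2 \<in> Sop_mat Pe" "lmat_star T * T\<^sub>2 \<in> Sop_mat Pte"
    using homog_Sop[OF tU fe] homog_Sop[OF tV' fe] T_entry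
    by (auto simp: Sop_mat_def Pe_def Pte_def)
  have sym: "mat_has_symmetry Pe" "mat_has_symmetry Pte"
  proof -
    have "Sop (U i l) \<noteq> {}" "Sop (lp_star (V l i)) \<noteq> {}" if "i < s" "l < s" for i l
      using homog_Sop[OF tU[OF that] fe[OF that]] homog_Sop[OF tV'[OF that] fe[OF that]] by blast+
    thus "mat_has_symmetry Pe" "mat_has_symmetry Pte"
      by (simp_all add: mat_has_symmetry_def has_symmetry_iff_Sop Pe_def Pte_def)
  qed
  have zero: "0\<^sub>m 1 s \<in> lmats F 1 s" "mat_has_symmetry (0\<^sub>m 1 s)"
    using assms(1) by (auto simp: lmats_def lmat_over_def mat_has_symmetry_def has_symmetry_def
        complex_subfield_def)
  \<comment> \<open>With \<open>J = 1\<close> the range \<open>{1..<J}\<close> of the compatibility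
    condition is empty.\<close>
  have factors: "\<exists>J \<ge> 1. \<exists>A At :: nat \<Rightarrow> lmat.
         Pe = desc_prod s A J \<and> Pte = desc_prod s At J \<and>
         (\<forall>j \<in> {1..J}. A j \<in> lmats F s s \<and> At j \<in> lmats F s s \<and>
            mat_has_symmetry (A j) \<and> mat_has_symmetry (At j) \<and> biorthogonal (A j) (At j)) \<and>
         (\<forall>j \<in> {1..<J}. mutually_compatible F (A (Suc j)) (A j) \<and>
            mutually_compatible F (At (Suc j)) (At j))"
    by (rule exI[of _ 1], intro conjI exI[of _ "\<lambda>_. Pe"] exI[of _ "\<lambda>_. Pte"])
      (use mem sym bio in \<open>auto simp: lmats_def\<close>)
  have "max (max_csupp_len Pe) (max_csupp_len Pte) \<le> max_csupp_len P + max_csupp_len Pt" if "r = 1"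
  proof -
    have "max_csupp_len A \<le> ereal (of_int L)"
      if "A \<in> {Pe, Pte}" for A
      using that l0(1) homog_csupp_len[OF tU] homog_csupp_len[OF tV']
      by (intro max_csupp_len_le[of _ s s]) (auto simp: Pe_def Pte_def)
    thus ?thesis using L[OF that] by (simp add: Lp(2) Lq(2))
  qed
  thus ?thesis
    using mem ext bio sym zero T Sop factors by blast
qed

end
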